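(* Let $P$ be a stochastic matrix indexed by $\mathbb F$ such that: (i) $P$ has the GI/G/1-type block form $$P=\begin{pmatrix}\boldsymbol B(0)&\boldsymbol B(1)&\boldsymbol B(2)&\cdots\\ \boldsymbol B(-1)&\boldsymbol A(0)&\boldsymbol A(1)&\cdots\\ \boldsymbol B(-2)&\boldsymbol A(-1)&\boldsymbol A(0)&\cdots\\ \vdots&\vdots&\vdots&\ddots\end{pmatrix}$$ with $d\times d$ matrices $\boldsymbol A(k),\boldsymbol B(k)$ ($k\in\mathbb Z$); (ii) $P\in\mathsf{BM}_d$; (iii) $P$ is irreducible and positive recurrent, with stationary probability vector $\pi$; (iv) $\boldsymbol A:=\sum_{k=-\infty}^{\infty}\boldsymbol A(k)$ is irreducible and stochastic; (v) $r_{A_+}:=\sup\{z>0:\sum_{k=0}^\infty z^k\boldsymbol A(k)\text{ is finite}\}>1$. Fix $\alpha\in(1,r_{A_+})$ with $\delta_A(\alpha)<1$ and put $v'(k,i)=\alpha^kv_A(\alpha,i)$ for $(k,i)\in\mathbb F$. Fix $\gamma'\in(0,1)$ and $k_*\in\mathbb N$ such that $$\sum_{l=0}^\infty P(k;l)\,\alpha^l v_A(\alpha)\le\gamma'\alpha^kv_A(\alpha)\qquad\text{for all }k\ge k_* .$$ Suppose that $\boldsymbol B(-K)e>0$ for some nonnegative integer $K\ge k_*-1$. Let $$b'=\inf\{x>0:\ x e\ge w(k)-\gamma'\alpha^kv_A(\alpha)\ \text{for all }0\le k\le K\},$$ let $\beta\in(0,\infty)$ be such that $\beta\,\boldsymbol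 B(-K)e\ge b'e$, and set $$\gamma=\frac{\gamma'+\beta}{1+\beta},\qquad b=b'+\beta,\qquad v(k,i)=\begin{cases}v'(0,i),&k=0,\ i\in\mathbb D,\\ v'(k,i)+\beta,&k\in\mathbb N,\ i\in\mathbb D.\end{cases}$$ Then for all $n\in\mathbb N$ and all $m\in\mathbb N$, $$\left\|{}_{(n)}\pi_n-\pi\right\|\le \frac{b}{1-\gamma}\left(4\gamma^m+2m\sum_{i\in\mathbb D}\frac{1}{v(n,i)}\right).$$
   Context: Notation: $\mathbb N=\{1,2,\dots\}$, $\mathbb Z_+=\{0,1,2,\dots\}$, $d\in\mathbb N$, $\mathbb D=\{1,\dots,d\}$, $\mathbb F=\mathbb Z_+\times\mathbb D$. Inequalities are entrywise; $e$ is the column vector of ones. $P=(p(k,i;l,j))_{(k,i),(l,j)\in\mathbb F}$ and $P(k;l)=(p(k,i;l,j))_{i,j\in\mathbb D}$ is its $(k,l)$ block; the block form means $P(0;l)=\boldsymbol B(l)$ for $l\ge0$, $P(k;0)=\boldsymbol B(-k)$ for $k\ge1$, and $P(k;l)=\boldsymbol A(l-k)$ for $k,l\ge1$. $P\in\mathsf{BM}_d$ (block-monotone with block size $d$) means $\sum_{m\ge l}p(k,i;m,j)\le\sum_{m\ge l}p(k+1,i;m,j)$ for all $k,l\in\mathbb Z_+$, $i,j\in\mathbb D$. Let $r_{A_-}=\sup\{z>0:\sum_{k=1}^\infty z^k\boldsymbol A(-k)\text{ is finite}\}\ge1$ and $\mathcal I_A=(1/r_{A_-},r_{A_+})\cup\{1\}$.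 For $z\in\mathcal I_A$, $\widehat{\boldsymbol A}(z)=\sum_{k=-\infty}^\infty z^k\boldsymbol A(k)$; $\delta_A(z)$ is the real, maximum-modulus (Perron–Frobenius) eigenvalue of $\widehat{\boldsymbol A}(z)$; and $v_A(z)=(v_A(z,i))_{i\in\mathbb D}$ is a corresponding right eigenvector, $\widehat{\boldsymbol A}(z)v_A(z)=\delta_A(z)v_A(z)$, normalized so that $v_A(z)\ge e$. (Under hypotheses (i)–(v), an $\alpha\in(1,r_{A_+})$ with $\delta_A(\alpha)<1$, and then $\gamma'$ and $k_*$ as in the claim, exist.) For $k\in\mathbb Z_+$, $w(k)=\sum_{l=0}^\infty P(k;l)\,\alpha^lv_A(\alpha)$, i.e. $w(0)=\sum_{l\ge0}\alpha^l\boldsymbol B(l)v_A(\alpha)$ and $w(k)=\boldsymbol B(-k)v_A(\alpha)+\alpha^k\sum_{l\ge-k+1}\alpha^l\boldsymbol A(l)v_A(\alpha)$ for $k\ge1$; these are finite. For $n\in\mathbb N$, the last-column-block-augmented truncation ${}_{(n)}P_n=({}_{(n)}p_n(k,i;l,j))$ of $P$ is the stochastic matrix indexed by $\mathbb F$ with ${}_{(n)}p_n(k,i;l,j)=p(k,i;l,j)$ for $l\le n-1$, ${}_{(n)}p_n(k,i;n,j)=\sum_{m\ge n}p(k,i;m,j)$, and ${}_{(n)}p_n(k,i;l,j)=0$ for $l>n$. ${}_{(n)}\pi_n$ denotes a stationary probability vector of ${}_{(n)}P_n$. $\|x\|=\sum_{(k,i)\in\mathbb F}|x(k,i)|$. 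*)

theory Defs
  imports "HOL-Analysis.Analysis"
begin

text \<open>
  Throughout, a matrix with (possibly infinite) index type \<open>'s\<close> is a function
  \<open>'s \<Rightarrow> 's \<Rightarrow> real\<close>. The phase set \<open>{1,\<dots>,d}\<close> is a finite type \<open>'d\<close> (so \<open>d = CARD('d)\<close>), the
  state space \<open>\<int>\<^sub>+ \<times> {1,\<dots>,d}\<close> is the type \<open>nat \<times> 'd\<close>, and \<open>d \<times> d\<close> blocks have type
  \<open>real ^ 'd ^ 'd\<close>.
\<close>

definition stochastic_matrix :: "('s \<Rightarrow> 's \<Rightarrow> real) \<Rightarrow> bool" where
  "stochastic_matrix P \<longleftrightarrow>
     (\<forall>x y. 0 \<le> P x y) \<and> (\<forall>x. ((\<lambda>y. P x y) has_sum 1) UNIV)"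

primrec matrix_power :: "('s \<Rightarrow> 's \<Rightarrow> real) \<Rightarrow> nat \<Rightarrow> 's \<Rightarrow> 's \<Rightarrow> real" where
  "matrix_power P 0 x y = (if x = y then 1 else 0)"
| "matrix_power P (Suc n) x y = (\<Sum>\<^sub>\<infinity>z. P x z * matrix_power P n z y)"

definition irreducible_matrix :: "('s \<Rightarrow> 's \<Rightarrow> real) \<Rightarrow> bool" where
  "irreducible_matrix P \<longleftrightarrow> (\<forall>x y. \<exists>n. 0 < matrix_power P n x y)"

text \<open>
  \<open>first_passage P n x y\<close> is the probability that the chain started in \<open>x\<close> visits \<open>y\<close>
  at time \<open>n \<ge> 1\<close> for the first time after time \<open>0\<close>; so for \<open>x = y\<close> it is the
  distribution of the return time, which has to be proper and to have finite mean.
\<close>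

primrec first_passage :: "('s \<Rightarrow> 's \<Rightarrow> real) \<Rightarrow> nat \<Rightarrow> 's \<Rightarrow> 's \<Rightarrow> real" where
  "first_passage P 0 x y = 0"
| "first_passage P (Suc n) x y =
     (if n = 0 then P x y else (\<Sum>\<^sub>\<infinity>z\<in>- {y}. P x z * first_passage P n z y))"

definition positive_recurrent :: "('s \<Rightarrow> 's \<Rightarrow> real) \<Rightarrow> bool" where
  "positive_recurrent P \<longleftrightarrow>
     (\<forall>x. (\<lambda>n. first_passage P n x x) sums 1 \<and>
          summable (\<lambda>n. real n * first_passage P n x x))"

definition stationary_prob :: "('s \<Rightarrow> 's \<Rightarrow> real) \<Rightarrow> ('s \<Rightarrow> real) \<Rightarrow> bool" where
  "stationary_prob P \<pi> \<longleftrightarrow>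
     (\<forall>x. 0 \<le> \<pi> x) \<and> (\<pi> has_sum 1) UNIV \<and>
     (\<forall>y. ((\<lambda>x. \<pi> x * P x y) has_sum \<pi> y) UNIV)"

definition l1_norm :: "('s \<Rightarrow> real) \<Rightarrow> real" where
  "l1_norm x = (\<Sum>\<^sub>\<infinity>s. \<bar>x s\<bar>)"

definition block :: "(nat \<times> 'd \<Rightarrow> nat \<times> 'd \<Rightarrow> real) \<Rightarrow> nat \<Rightarrow> nat \<Rightarrow> real ^ 'd ^ 'd" where
  "block P k l = (\<chi> i j. P (k, i) (l, j))"

definition GI_G_1_form ::
  "(nat \<times> 'd \<Rightarrow> nat \<times> 'd \<Rightarrow> real) \<Rightarrow> (int \<Rightarrow> real ^ 'd ^ 'd) \<Rightarrow> (int \<Rightarrow> real ^ 'd ^ 'd) \<Rightarrow> bool"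
  where
  "GI_G_1_form P A B \<longleftrightarrow>
     (\<forall>l. block P 0 l = B (int l)) \<and>
     (\<forall>k\<ge>1. block P k 0 = B (- int k)) \<and>
     (\<forall>k\<ge>1. \<forall>l\<ge>1. block P k l = A (int l - int k))"

definition block_monotone :: "(nat \<times> 'd \<Rightarrow> nat \<times> 'd \<Rightarrow> real) \<Rightarrow> bool" where
  "block_monotone P \<longleftrightarrow>
     (\<forall>k l i j. (\<Sum>\<^sub>\<infinity>m\<in>{l..}. P (k, i) (m, j)) \<le> (\<Sum>\<^sub>\<infinity>m\<in>{l..}. P (Suc k, i) (m, j)))"

fun last_column_truncation ::
  "nat \<Rightarrow> (nat \<times> 'd \<Rightarrow> nat \<times> 'd \<Rightarrow> real) \<Rightarrow> nat \<times> 'd \<Rightarrow> nat \<times> 'd \<Rightarrow> real" where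
  "last_column_truncation n P (k, i) (l, j) =
     (if l < n then P (k, i) (l, j)
      else if l = n then (\<Sum>\<^sub>\<infinity>m\<in>{n..}. P (k, i) (m, j))
      else 0)"

text \<open>An extended real, since the supremum may be \<open>\<infinity>\<close>.\<close>

definition r_plus :: "(int \<Rightarrow> real ^ 'd ^ 'd) \<Rightarrow> ereal" where
  "r_plus A = Sup {ereal z |z. 0 < z \<and> (\<lambda>k::nat. z ^ k *\<^sub>R A (int k)) summable_on UNIV}"

definition A_hat :: "(int \<Rightarrow> real ^ 'd ^ 'd) \<Rightarrow> real \<Rightarrow> real ^ 'd ^ 'd" where
  "A_hat A z = (\<Sum>\<^sub>\<infinity>k. (z powi k) *\<^sub>R A k)"

definition complex_eigenvalue :: "real ^ 'd ^ 'd \<Rightarrow> complex \<Rightarrow> bool" where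
  "complex_eigenvalue M \<mu> \<longleftrightarrow>
     (\<exists>u :: complex ^ 'd. u \<noteq> 0 \<and> (\<chi> i j. complex_of_real (M $ i $ j)) *v u = \<mu> *s u)"

text \<open>
  The bound by \<open>r\<close> itself (not by \<open>\<bar>r\<bar>\<close>) makes the Perron--Frobenius eigenvalue nonnegative and
  hence unique, also when \<open>- r\<close> is an eigenvalue too.
\<close>

definition is_perron_eigenvalue :: "real ^ 'd ^ 'd \<Rightarrow> real \<Rightarrow> bool" where
  "is_perron_eigenvalue M r \<longleftrightarrow>
     complex_eigenvalue M (complex_of_real r) \<and> (\<forall>\<mu>. complex_eigenvalue M \<mu> \<longrightarrow> cmod \<mu> \<le> r)"

lemma is_perron_eigenvalue_unique:
  assumes "is_perron_eigenvalue M r" and "is_perron_eigenvalue M s"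
  shows "r = s"
  using assms unfolding is_perron_eigenvalue_def by (metis abs_le_D1 norm_of_real order_antisym)

definition delta_A :: "(int \<Rightarrow> real ^ 'd ^ 'd) \<Rightarrow> real \<Rightarrow> real" where
  "delta_A A z = (THE r. is_perron_eigenvalue (A_hat A z) r)"

definition w_vec ::
  "(nat \<times> 'd \<Rightarrow> nat \<times> 'd \<Rightarrow> real) \<Rightarrow> real \<Rightarrow> real ^ 'd \<Rightarrow> nat \<Rightarrow> real ^ 'd" where
  "w_vec P \<alpha> u k = (\<Sum>\<^sub>\<infinity>l. block P k l *v (\<alpha> ^ l *\<^sub>R u))"

end

theory Submission
  imports Defs
begin

text \<open>
  Let \<open>w\<close> be the common phase marginal of \<open>\<pi>\<close> and \<open>\<pi>\<^sub>n\<close>, placed on level \<open>0\<close>, and let \<open>P\<^sub>n\<close> be the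
  truncated matrix, which is again block-monotone because its rows are the images of the rows of
  \<open>P\<close> under \<open>(l, j) \<mapsto> (min l n, j)\<close>. Split \<open>\<pi>\<^sub>n - \<pi>\<close> as
  \<open>(\<pi>\<^sub>n - w P\<^sub>n\<^sup>m) + w (P\<^sub>n\<^sup>m - P\<^sup>m) + (w P\<^sup>m - \<pi>)\<close>.
  By monotonicity a chain started from level \<open>0\<close> has met one started from the same phase at
  level \<open>k\<close> when the latter first hits level \<open>0\<close>, and the drift inequality for \<open>v\<close> bounds the
  probability that this takes longer than \<open>m\<close> steps by \<open>\<gamma>\<^sup>m v(k, i)\<close>; so each outer term is at most
  \<open>2 \<gamma>\<^sup>m\<close> times the mean of \<open>v\<close>, which is at most \<open>b / (1 - \<gamma>)\<close>. The middle term telescopes into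
  \<open>m\<close> terms, each at most twice the probability of a jump above level \<open>n\<close> after some number
  of steps from \<open>w\<close>. By monotonicity this is at most the \<open>\<pi>\<close>-mass above level \<open>n\<close>, which
  Markov's inequality for \<open>v\<close> controls.
\<close>

section \<open>Means under a probability vector\<close>

definition prob_vec :: "('s \<Rightarrow> real) \<Rightarrow> bool" where
  "prob_vec p \<longleftrightarrow> (\<forall>x. 0 \<le> p x) \<and> (p has_sum 1) UNIV"

abbreviation has_mean :: "('s \<Rightarrow> real) \<Rightarrow> ('s \<Rightarrow> real) \<Rightarrow> bool" where
  "has_mean p f \<equiv> (\<lambda>x. p x * f x) summable_on UNIV"

text \<open>A series that is not summable has \<open>infsum\<close> 0, so a value of
  \<open>expect\<close> is meaningful only alongside \<open>has_mean\<close>. Scaling by a constant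
  respects this default, addition does not.\<close>

definition expect :: "('s \<Rightarrow> real) \<Rightarrow> ('s \<Rightarrow> real) \<Rightarrow> real" where
  "expect p f = (\<Sum>\<^sub>\<infinity>x. p x * f x)"

lemma stochastic_matrix_iff: "stochastic_matrix P \<longleftrightarrow> (\<forall>x. prob_vec (P x))"
  unfolding stochastic_matrix_def prob_vec_def by auto

lemma stochastic_matrixD: "stochastic_matrix P \<Longrightarrow> prob_vec (P x)"
  by (simp add: stochastic_matrix_iff)

lemma stationary_prob_prob_vec: "stationary_prob P p \<Longrightarrow> prob_vec p"
  by (simp add: stationary_prob_def prob_vec_def)

lemma prob_vec_nonneg: "prob_vec p \<Longrightarrow> 0 \<le> p x"
  by (simp add: prob_vec_def)

lemma prob_vec_summable: "prob_vec p \<Longrightarrow> p summable_on UNIV"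
  by (auto simp: prob_vec_def summable_on_def)

lemma has_mean_bounded:
  assumes "prob_vec p" "\<And>x. \<bar>f x\<bar> \<le> c"
  shows "has_mean p f"
proof -
  have "(\<lambda>x. p x * c) summable_on UNIV"
    using prob_vec_summable[OF assms(1)] by (rule summable_on_cmult_left)
  then have "(\<lambda>x. \<bar>p x * f x\<bar>) summable_on UNIV"
    by (rule summable_on_comparison_test)
      (auto simp: abs_mult prob_vec_nonneg[OF assms(1)] intro: mult_left_mono assms(2))
  then show ?thesis
    by (subst summable_on_iff_abs_summable_on_real) simp
qed

lemma has_mean_le:
  assumes "prob_vec p" "has_mean p g" "\<And>x. 0 \<le> f x" "\<And>x. f x \<le> g x"
  shows "has_mean p f"
  using assms(2) by (rule summable_on_comparison_test)
    (auto intro: mult_left_mono mult_nonneg_nonneg assms prob_vec_nonneg)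

lemma has_mean_add: "has_mean p f \<Longrightarrow> has_mean p g \<Longrightarrow> has_mean p (\<lambda>x. f x + g x)"
  by (simp add: ring_distribs summable_on_add)

lemma has_mean_cmult: "has_mean p f \<Longrightarrow> has_mean p (\<lambda>x. c * f x)"
  using summable_on_cmult_right[of "\<lambda>x. p x * f x" UNIV c] by (simp add: mult.left_commute)

lemma has_mean_diff: "has_mean p f \<Longrightarrow> has_mean p g \<Longrightarrow> has_mean p (\<lambda>x. f x - g x)"
  using has_mean_add[of p f "\<lambda>x. - 1 * g x"] has_mean_cmult[of p g "- 1"] by simp

lemma expect_add:
  "has_mean p f \<Longrightarrow> has_mean p g \<Longrightarrow> expect p (\<lambda>x. f x + g x) = expect p f + expect p g"
  unfolding expect_def by (simp add: ring_distribs infsum_add)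

lemma expect_cmult: "expect p (\<lambda>x. c * f x) = c * expect p f"
  unfolding expect_def by (subst infsum_cmult_right'[symmetric]) (simp add: mult.left_commute)

lemma expect_uminus: "expect p (\<lambda>x. - f x) = - expect p f"
  using expect_cmult[of p "- 1" f] by simp

lemma expect_diff:
  "has_mean p f \<Longrightarrow> has_mean p g \<Longrightarrow> expect p (\<lambda>x. f x - g x) = expect p f - expect p g"
  using expect_add[of p f "\<lambda>x. - 1 * g x"] has_mean_cmult[of p g "- 1"] expect_cmult[of p "- 1" g]
  by simp

lemma expect_const: "prob_vec p \<Longrightarrow> expect p (\<lambda>x. c) = c"
  unfolding expect_def prob_vec_def
  using infsumI[OF has_sum_cmult_left[of p UNIV 1 c]] by simp

lemma expect_mono:
  assumes "prob_vec p" "has_mean p f" "has_mean p g" "\<And>x. f x \<le> g x"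
  shows "expect p f \<le> expect p g"
  unfolding expect_def
  by (rule infsum_mono[OF assms(2,3)]) (auto intro: mult_left_mono assms prob_vec_nonneg)

lemma expect_abs_le:
  assumes "prob_vec p" "has_mean p g" "\<And>x. \<bar>f x\<bar> \<le> g x"
  shows "\<bar>expect p f\<bar> \<le> expect p g"
proof -
  have "(\<lambda>x. \<bar>p x * f x\<bar>) summable_on UNIV"
    using assms(2) by (rule summable_on_comparison_test)
      (auto simp: abs_mult prob_vec_nonneg[OF assms(1)] intro: mult_left_mono assms)
  then have f: "has_mean p f"
    by (subst summable_on_iff_abs_summable_on_real) simp
  have "expect p f \<le> expect p g"
    using assms by (intro expect_mono f) (auto dest: abs_le_D1)
  moreover have "expect p (\<lambda>x. - f x) \<le> expect p g"
    using assms has_mean_cmult[OF f, of "- 1"] by (intro expect_mono) (auto dest: abs_le_D2)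
  ultimately show ?thesis by (simp add: expect_uminus)
qed

lemma expect_abs_le_const:
  assumes "prob_vec p" "\<And>x. \<bar>f x\<bar> \<le> c"
  shows "\<bar>expect p f\<bar> \<le> c"
  using expect_abs_le[of p "\<lambda>_. c" f] assms has_mean_bounded[of p "\<lambda>_. c" "\<bar>c\<bar>"] expect_const[of p c]
  by auto

lemma expect_nonneg:
  assumes "prob_vec p" "\<And>x. 0 \<le> f x"
  shows "0 \<le> expect p f"
  unfolding expect_def by (rule infsum_nonneg) (auto simp: assms prob_vec_nonneg)

text \<open>Interchange of summation; the bound \<open>c\<close> makes the double series absolutely
  summable.\<close>

lemma expect_stationary:
  assumes P: "stochastic_matrix P" and p: "stationary_prob P p" and f: "\<And>x. \<bar>f x\<bar> \<le> c"
  shows "expect p (\<lambda>x. expect (P x) f) = expect p f"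
proof -
  note pv = stationary_prob_prob_vec[OF p]
  have "(\<lambda>(x, y). p x * P x y) summable_on UNIV \<times> UNIV"
  proof (rule summable_on_SigmaI)
    show "((\<lambda>y. case (x, y) of (x, y) \<Rightarrow> p x * P x y) has_sum p x * 1) UNIV" for x
      using has_sum_cmult_right[of "P x" UNIV 1 "p x"] stochastic_matrixD[OF P, of x]
      by (simp add: prob_vec_def)
    show "(\<lambda>x. p x * 1) summable_on UNIV"
      using prob_vec_summable[OF pv] by simp
  qed (auto intro: mult_nonneg_nonneg prob_vec_nonneg[OF pv]
        prob_vec_nonneg[OF stochastic_matrixD[OF P]])
  then have "(\<lambda>z. (case z of (x, y) \<Rightarrow> p x * P x y) * c) summable_on UNIV \<times> UNIV"
    by (rule summable_on_cmult_left)
  then have "(\<lambda>z. \<bar>case z of (x, y) \<Rightarrow> p x * P x y * f y\<bar>) summable_on UNIV \<times> UNIV"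
    by (rule summable_on_comparison_test)
      (auto simp: abs_mult prob_vec_nonneg[OF pv] prob_vec_nonneg[OF stochastic_matrixD[OF P]]
        intro!: mult_left_mono f)
  then have "(\<lambda>(x, y). p x * P x y * f y) summable_on UNIV \<times> UNIV"
    by (subst summable_on_iff_abs_summable_on_real) simp
  from infsum_swap_banach[OF this]
  have "(\<Sum>\<^sub>\<infinity>x. \<Sum>\<^sub>\<infinity>y. p x * P x y * f y) = (\<Sum>\<^sub>\<infinity>y. \<Sum>\<^sub>\<infinity>x. p x * P x y * f y)" .
  moreover have "(\<Sum>\<^sub>\<infinity>y. p x * P x y * f y) = p x * expect (P x) f" for x
    unfolding expect_def by (subst infsum_cmult_right'[symmetric]) (simp add: mult.assoc)
  moreover have "(\<Sum>\<^sub>\<infinity>x. p x * P x y * f y) = p y * f y" for y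
  proof -
    have "((\<lambda>x. p x * P x y * f y) has_sum p y * f y) UNIV"
      using p unfolding stationary_prob_def by (intro has_sum_cmult_left) auto
    then show ?thesis by (rule infsumI)
  qed
  ultimately show ?thesis by (simp add: expect_def)
qed

text \<open>
  The mean of \<open>v\<close> is not known to be finite beforehand, hence the truncations \<open>min v c\<close>:
  concavity of \<open>min\<close> gives them a drift inequality of the same form.
\<close>

lemma stationary_drift_bound:
  assumes P: "stochastic_matrix P" and p: "stationary_prob P p"
    and v: "\<And>x. 0 \<le> v x" "\<And>x. has_mean (P x) v"
    and drift: "\<And>x. expect (P x) v \<le> \<gamma> * v x + b"
    and \<gamma>: "0 \<le> \<gamma>" "\<gamma> < 1" and b: "0 \<le> b"
  shows "has_mean p v" "expect p v \<le> b / (1 - \<gamma>)"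
proof -
  note pv = stationary_prob_prob_vec[OF p]
  have fin: "(\<Sum>x\<in>F. p x * v x) \<le> b / (1 - \<gamma>)" if F: "finite F" for F
  proof -
    \<comment> \<open>This cap lies above \<open>v\<close> on all of \<open>F\<close>, so on
      \<open>F\<close> the truncations are inactive although they stay bounded everywhere.\<close>
    define c where "c = (\<Sum>x\<in>F. v x)"
    have c0: "0 \<le> c" unfolding c_def by (rule sum_nonneg) (rule v)
    have vc: "v x \<le> c" if "x \<in> F" for x
      unfolding c_def using F that v(1) by (intro member_le_sum) auto
    have b1: "\<bar>min (v x) c\<bar> \<le> c" and b2: "\<bar>min (\<gamma> * v x) c\<bar> \<le> c" for x
      using v(1)[of x] c0 \<gamma>(1) mult_nonneg_nonneg[OF \<gamma>(1) v(1)[of x]] by (auto simp: min_def)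
    have m1: "has_mean p (\<lambda>x. min (v x) c)" and m2: "has_mean p (\<lambda>x. min (\<gamma> * v x) c)"
      using has_mean_bounded[OF pv, of "\<lambda>x. min (v x) c", OF b1]
        has_mean_bounded[OF pv, of "\<lambda>x. min (\<gamma> * v x) c", OF b2] .
    have mb: "has_mean p (\<lambda>_. b)" by (rule has_mean_bounded[OF pv, of _ "\<bar>b\<bar>"]) simp
    \<comment> \<open>Truncation both lowers the mean of \<open>v\<close>, so that the drift
      applies, and caps it at \<open>c\<close>; as \<open>b\<close> is nonnegative it can be taken
      out of the minimum.\<close>
    have "expect (P x) (\<lambda>x. min (v x) c) \<le> min (\<gamma> * v x) c + b" for x
    proof -
      note px = stochastic_matrixD[OF P, of x]
      have mx: "has_mean (P x) (\<lambda>x. min (v x) c)" by (rule has_mean_bounded[OF px b1])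
      have "expect (P x) (\<lambda>x. min (v x) c) \<le> expect (P x) v"
        by (intro expect_mono px mx v) auto
      moreover have "expect (P x) (\<lambda>x. min (v x) c) \<le> c"
        using expect_abs_le_const[OF px, of "\<lambda>x. min (v x) c", OF b1] by simp
      ultimately show ?thesis using drift[of x] b by (simp add: min_def)
    qed
    then have "expect p (\<lambda>x. expect (P x) (\<lambda>x. min (v x) c)) \<le> expect p (\<lambda>x. min (\<gamma> * v x) c + b)"
      by (intro expect_mono[OF pv] has_mean_bounded[OF pv, of _ c] has_mean_add m2 mb
          expect_abs_le_const[OF stochastic_matrixD[OF P]] b1)
    \<comment> \<open>By invariance the left side is the mean of \<open>min (v x) c\<close> itself,
      and finite means may be subtracted.\<close>
    then have *: "expect p (\<lambda>x. min (v x) c - min (\<gamma> * v x) c) \<le> b"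
      by (simp add: expect_stationary[OF P p b1] expect_add[OF m2 mb] expect_diff[OF m1 m2]
          expect_const[OF pv])
    have \<gamma>v: "\<gamma> * v x \<le> v x" for x using mult_left_le_one_le[OF v(1) \<gamma>(1)] \<gamma>(2) by simp
    have "(\<Sum>x\<in>F. p x * v x) * (1 - \<gamma>) = (\<Sum>x\<in>F. p x * (min (v x) c - min (\<gamma> * v x) c))"
      unfolding sum_distrib_right
    proof (rule sum.cong[OF refl])
      fix x assume "x \<in> F"
      then have "v x \<le> c" "\<gamma> * v x \<le> c" using vc[of x] \<gamma>v[of x] by auto
      then show "p x * v x * (1 - \<gamma>) = p x * (min (v x) c - min (\<gamma> * v x) c)"
        by (simp add: algebra_simps)
    qed
    also have "\<dots> \<le> expect p (\<lambda>x. min (v x) c - min (\<gamma> * v x) c)"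
      unfolding expect_def using has_mean_diff[OF m1 m2] F
    proof (rule finite_sum_le_infsum)
      show "0 \<le> p x * (min (v x) c - min (\<gamma> * v x) c)" for x
        using \<gamma>v[of x] by (intro mult_nonneg_nonneg prob_vec_nonneg[OF pv]) (auto simp: min_def)
    qed auto
    also note *
    finally show ?thesis using \<gamma> by (simp add: pos_le_divide_eq)
  qed
  show m: "has_mean p v"
    by (rule nonneg_bdd_above_summable_on)
      (auto intro!: mult_nonneg_nonneg prob_vec_nonneg[OF pv] v bdd_aboveI2 fin)
  show "expect p v \<le> b / (1 - \<gamma>)"
    unfolding expect_def by (rule infsum_le_finite_sums[OF m fin])
qed

section \<open>Block-monotonicity and the drift contraction\<close>

lemma has_sum_columns:
  fixes f :: "nat \<times> 'd::finite \<Rightarrow> real"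
  assumes "\<And>j. ((\<lambda>l. f (l, j)) has_sum S j) UNIV"
  shows "(f has_sum (\<Sum>j\<in>UNIV. S j)) UNIV"
proof -
  have "(f has_sum (\<Sum>j\<in>UNIV. S j)) (\<Union>j\<in>UNIV. range (\<lambda>l. (l, j)))"
  proof (rule sum_has_sum)
    show "(f has_sum S j) (range (\<lambda>l. (l, j)))" for j
      using assms[of j] by (subst has_sum_reindex) (auto simp: inj_on_def comp_def)
  qed auto
  moreover have "(\<Union>j\<in>UNIV. range (\<lambda>l. (l, j))) = (UNIV :: (nat \<times> 'd) set)"
    by auto
  ultimately show ?thesis by simp
qed

lemma summable_on_column:
  fixes f :: "nat \<times> 'd \<Rightarrow> real"
  assumes "f summable_on UNIV"
  shows "(\<lambda>l. f (l, j)) summable_on S"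
proof -
  have "f summable_on (\<lambda>l. (l, j)) ` S"
    by (rule summable_on_subset_banach[OF assms]) simp
  then show ?thesis by (subst (asm) summable_on_reindex) (auto simp: inj_on_def comp_def)
qed

lemma infsum_columns:
  fixes f :: "nat \<times> 'd::finite \<Rightarrow> real"
  assumes "f summable_on UNIV"
  shows "infsum f UNIV = (\<Sum>j\<in>UNIV. \<Sum>\<^sub>\<infinity>l. f (l, j))"
  by (intro infsumI has_sum_columns has_sum_infsum summable_on_column assms)

lemma has_sum_finite_sum:
  fixes f :: "'a \<Rightarrow> 'b \<Rightarrow> real"
  assumes "finite I" "\<And>i. i \<in> I \<Longrightarrow> (f i has_sum S i) A"
  shows "((\<lambda>x. \<Sum>i\<in>I. f i x) has_sum (\<Sum>i\<in>I. S i)) A"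
  using assms by (induction I rule: finite_induct) (auto intro: has_sum_add)

text \<open>The increments of \<phi> are collected up to level l and stopped at \<open>N\<close>;
  the indicator \<open>Suc t \<le> l\<close> selects exactly those that are passed.\<close>

lemma mono_clamp_telescope:
  fixes \<phi> :: "nat \<Rightarrow> real"
  shows "\<phi> (min l N) = \<phi> 0 + (\<Sum>t<N. (\<phi> (Suc t) - \<phi> t) * (if Suc t \<le> l then 1 else 0))"
proof (induction N)
  case (Suc N)
  then show ?case
    by (cases "Suc N \<le> l") (auto simp: min_def not_le less_Suc_eq_le le_antisym)
qed simp

text \<open>Summation by parts: a mean becomes a combination of tail sums. Clamping at
  \<open>N\<close> keeps the sum over \<open>t\<close> finite, so no infinite double sum has to be
  interchanged.\<close>

lemma infsum_clamp:
  fixes a \<phi> :: "nat \<Rightarrow> real"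
  assumes a: "\<And>l. 0 \<le> a l" "a summable_on UNIV"
  shows "((\<lambda>l. a l * \<phi> (min l N)) has_sum
           (\<phi> 0 * infsum a {0..} + (\<Sum>t<N. (\<phi> (Suc t) - \<phi> t) * infsum a {Suc t..}))) UNIV"
proof -
  have tail: "((\<lambda>l. a l * (if Suc t \<le> l then 1 else 0)) has_sum infsum a {Suc t..}) UNIV" for t
  proof -
    have "(a has_sum infsum a {Suc t..}) {Suc t..}"
      by (rule has_sum_infsum[OF summable_on_subset_banach[OF a(2)]]) simp
    then show ?thesis by (subst has_sum_cong_neutral[where T = "{Suc t..}" and g = a]) auto
  qed
  have "((\<lambda>l. a l * \<phi> 0 + (\<Sum>t<N. (\<phi> (Suc t) - \<phi> t) * (a l * (if Suc t \<le> l then 1 else 0)))) has_sum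
      (infsum a UNIV * \<phi> 0 + (\<Sum>t<N. (\<phi> (Suc t) - \<phi> t) * infsum a {Suc t..}))) UNIV"
    by (intro has_sum_add has_sum_cmult_left has_sum_infsum a has_sum_finite_sum has_sum_cmult_right tail finite_lessThan)
  moreover have "a l * \<phi> 0 + (\<Sum>t<N. (\<phi> (Suc t) - \<phi> t) * (a l * (if Suc t \<le> l then 1 else 0)))
      = a l * \<phi> (min l N)" for l
    by (subst mono_clamp_telescope) (simp add: ring_distribs sum_distrib_left mult.left_commute)
  ultimately show ?thesis by (simp add: mult.commute)
qed

text \<open>After summation by parts the tails are weighted by \<open>\<phi> 0\<close> and the
  increments of \<phi>, all nonnegative. Working with finite partial sums also yields summability
  for \<open>p\<close>, which \<open>GI_G_1_column_summable\<close> uses for the rows of level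
  0.\<close>

lemma tail_dominated_infsum_le:
  fixes p q \<phi> :: "nat \<Rightarrow> real"
  assumes p: "\<And>l. 0 \<le> p l" "p summable_on UNIV"
    and q: "\<And>l. 0 \<le> q l" "q summable_on UNIV"
    and tail: "\<And>l. infsum p {l..} \<le> infsum q {l..}"
    and \<phi>: "mono \<phi>" "\<And>l. 0 \<le> \<phi> l"
    and s: "(\<lambda>l. q l * \<phi> l) summable_on UNIV"
  shows "(\<lambda>l. p l * \<phi> l) summable_on UNIV"
    and "(\<Sum>\<^sub>\<infinity>l. p l * \<phi> l) \<le> (\<Sum>\<^sub>\<infinity>l. q l * \<phi> l)"
proof -
  have part: "(\<Sum>l\<in>F. p l * \<phi> l) \<le> (\<Sum>\<^sub>\<infinity>l. q l * \<phi> l)" if F: "finite F" for F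
  proof -
    \<comment> \<open>Clamping at the largest index leaves \<phi> unchanged on \<open>F\<close>; for
      empty \<open>F\<close> both sums over \<open>F\<close> are 0 whatever \<open>N\<close>
      is.\<close>
    define N where "N = Max F"
    note cp = infsum_clamp[OF p, of \<phi> N] and cq = infsum_clamp[OF q, of \<phi> N]
    have "(\<Sum>l\<in>F. p l * \<phi> l) = (\<Sum>l\<in>F. p l * \<phi> (min l N))"
      using F by (intro sum.cong) (auto simp: N_def min_def dest: Max_ge)
    also have "\<dots> \<le> \<phi> 0 * infsum p {0..} + (\<Sum>t<N. (\<phi> (Suc t) - \<phi> t) * infsum p {Suc t..})"
      by (rule finite_sum_le_has_sum[OF cp F]) (auto intro: mult_nonneg_nonneg p \<phi>)
    also have "\<dots> \<le> \<phi> 0 * infsum q {0..} + (\<Sum>t<N. (\<phi> (Suc t) - \<phi> t) * infsum q {Suc t..})"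
      by (intro add_mono mult_left_mono tail sum_mono) (auto simp: \<phi>(2) intro: monoD[OF \<phi>(1)])
    also have "\<dots> \<le> (\<Sum>\<^sub>\<infinity>l. q l * \<phi> l)"
      by (rule has_sum_mono[OF cq has_sum_infsum[OF s]])
        (auto intro!: mult_left_mono q monoD[OF \<phi>(1)])
    finally show ?thesis .
  qed
  show sp: "(\<lambda>l. p l * \<phi> l) summable_on UNIV"
    by (rule nonneg_bdd_above_summable_on) (auto intro!: mult_nonneg_nonneg p \<phi> bdd_aboveI2 part)
  show "(\<Sum>\<^sub>\<infinity>l. p l * \<phi> l) \<le> (\<Sum>\<^sub>\<infinity>l. q l * \<phi> l)"
    by (rule infsum_le_finite_sums[OF sp part])
qed

section \<open>The phasewise tail order and block-increasing functions\<close>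

definition block_le :: "(nat \<times> 'd \<Rightarrow> real) \<Rightarrow> (nat \<times> 'd \<Rightarrow> real) \<Rightarrow> bool" where
  "block_le p q \<longleftrightarrow> (\<forall>l j. (\<Sum>\<^sub>\<infinity>m\<in>{l..}. p (m, j)) \<le> (\<Sum>\<^sub>\<infinity>m\<in>{l..}. q (m, j)))"

definition block_incr :: "(nat \<times> 'd \<Rightarrow> real) \<Rightarrow> bool" where
  "block_incr f \<longleftrightarrow> (\<forall>i. mono (\<lambda>k. f (k, i)))"

lemma block_incrI: "(\<And>k l i. k \<le> l \<Longrightarrow> f (k, i) \<le> f (l, i)) \<Longrightarrow> block_incr f"
  by (auto simp: block_incr_def mono_def)

lemma block_incrD: "block_incr f \<Longrightarrow> k \<le> l \<Longrightarrow> f (k, i) \<le> f (l, i)"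
  by (auto simp: block_incr_def mono_def)

lemma block_monotone_block_le:
  assumes "block_monotone P" "k \<le> l"
  shows "block_le (P (k, i)) (P (l, i))"
  unfolding block_le_def
proof (intro allI)
  fix a j
  show "(\<Sum>\<^sub>\<infinity>m\<in>{a..}. P (k, i) (m, j)) \<le> (\<Sum>\<^sub>\<infinity>m\<in>{a..}. P (l, i) (m, j))"
    using lift_Suc_mono_le[of "\<lambda>k. \<Sum>\<^sub>\<infinity>m\<in>{a..}. P (k, i) (m, j)" k l] assms
    by (auto simp: block_monotone_def)
qed

lemma block_le_expect_le:
  fixes p q :: "nat \<times> 'd::finite \<Rightarrow> real"
  assumes p: "prob_vec p" and q: "prob_vec q" and le: "block_le p q"
    and f: "block_incr f" "\<And>x. \<bar>f x\<bar> \<le> c"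
  shows "expect p f \<le> expect q f"
proof -
  \<comment> \<open>Tail domination is stated for nonnegative functions; the shift by
    \<open>c\<close> achieves this and changes both means equally.\<close>
  have g: "\<bar>f x + c\<bar> \<le> 2 * c" for x using f(2)[of x] by auto
  have hc: "has_mean r (\<lambda>_. c)" if "prob_vec r" for r
    by (rule has_mean_bounded[OF that, of _ "\<bar>c\<bar>"]) simp
  have sp: "has_mean p (\<lambda>x. f x + c)" and sq: "has_mean q (\<lambda>x. f x + c)"
    by (rule has_mean_bounded[OF p g], rule has_mean_bounded[OF q g])
  have "expect p (\<lambda>x. f x + c) \<le> expect q (\<lambda>x. f x + c)"
    unfolding expect_def infsum_columns[OF sp] infsum_columns[OF sq]
  proof (rule sum_mono, rule tail_dominated_infsum_le(2))
    fix j
    show "mono (\<lambda>l. f (l, j) + c)" using f(1) by (auto simp: block_incr_def mono_def)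
    show "0 \<le> f (l, j) + c" for l using f(2)[of "(l, j)"] by auto
    show "(\<lambda>l. q (l, j) * (f (l, j) + c)) summable_on UNIV"
      using summable_on_column[OF sq] .
    show "infsum (\<lambda>l. p (l, j)) {l..} \<le> infsum (\<lambda>l. q (l, j)) {l..}" for l
      using le by (simp add: block_le_def)
  qed (auto intro: prob_vec_nonneg p q summable_on_column prob_vec_summable)
  then show ?thesis
    using expect_add[OF has_mean_bounded[OF p f(2)] hc[OF p]]
      expect_add[OF has_mean_bounded[OF q f(2)] hc[OF q]]
      expect_const[OF p] expect_const[OF q] by simp
qed

text \<open>
  The rows of a block-monotone matrix enter the argument only through this property, which the
  truncated matrix inherits.
\<close>

definition preserves_block_incr :: "(nat \<times> 'd \<Rightarrow> nat \<times> 'd \<Rightarrow> real) \<Rightarrow> bool" where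
  "preserves_block_incr M \<longleftrightarrow>
     (\<forall>f c. block_incr f \<longrightarrow> (\<forall>x. \<bar>f x\<bar> \<le> c) \<longrightarrow> block_incr (\<lambda>x. expect (M x) f))"

lemma preserves_block_incrD:
  "preserves_block_incr M \<Longrightarrow> block_incr f \<Longrightarrow> (\<And>x. \<bar>f x\<bar> \<le> c) \<Longrightarrow> block_incr (\<lambda>x. expect (M x) f)"
  by (auto simp: preserves_block_incr_def)

lemma block_monotone_preserves_block_incr:
  fixes P :: "nat \<times> 'd::finite \<Rightarrow> nat \<times> 'd \<Rightarrow> real"
  assumes "stochastic_matrix P" "block_monotone P"
  shows "preserves_block_incr P"
  unfolding preserves_block_incr_def
proof (intro allI impI block_incrI)
  fix f :: "nat \<times> 'd \<Rightarrow> real" and c k l i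
  assume "block_incr f" "\<forall>x. \<bar>f x\<bar> \<le> c" "k \<le> (l::nat)"
  then show "expect (P (k, i)) f \<le> expect (P (l, i)) f"
    using assms by (intro block_le_expect_le[of _ _ f c] stochastic_matrixD block_monotone_block_le) auto
qed

text \<open>A function of the phase alone and its negative are both block-increasing, so its
  one-step mean is both nondecreasing and nonincreasing in the level.\<close>

lemma expect_phase_function:
  fixes M :: "nat \<times> 'd::finite \<Rightarrow> nat \<times> 'd \<Rightarrow> real"
  assumes "preserves_block_incr M"
  shows "expect (M (k, i)) (\<lambda>x. \<psi> (snd x)) = expect (M (0, i)) (\<lambda>x. \<psi> (snd x))"
proof -
  have b: "\<bar>\<psi> j\<bar> \<le> (\<Sum>j\<in>UNIV. \<bar>\<psi> j\<bar>)" for j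
    by (rule member_le_sum) auto
  have "block_incr (\<lambda>x. expect (M x) (\<lambda>x. \<psi> (snd x)))"
    by (rule preserves_block_incrD[OF assms, where c = "\<Sum>j\<in>UNIV. \<bar>\<psi> j\<bar>"])
      (auto simp: block_incr_def mono_def b)
  moreover have "block_incr (\<lambda>x. expect (M x) (\<lambda>x. - \<psi> (snd x)))"
    by (rule preserves_block_incrD[OF assms, where c = "\<Sum>j\<in>UNIV. \<bar>\<psi> j\<bar>"])
      (auto simp: block_incr_def mono_def b)
  ultimately show ?thesis
    using block_incrD[of "\<lambda>x. expect (M x) (\<lambda>x. \<psi> (snd x))" 0 k i]
      block_incrD[of "\<lambda>x. expect (M x) (\<lambda>x. - \<psi> (snd x))" 0 k i]
    by (simp add: expect_uminus)
qed

text \<open>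
  This replaces the monotone coupling of two copies of the chain started in \<open>(k, i)\<close> and
  \<open>(l, i)\<close>: the running minimum \<open>\<phi>\<close> of \<open>f\<close> over the levels is block-decreasing and satisfies
  \<open>f - D v \<le> \<phi> \<le> f\<close>.
\<close>

lemma drift_contraction:
  fixes M :: "nat \<times> 'd::finite \<Rightarrow> nat \<times> 'd \<Rightarrow> real"
  assumes M: "stochastic_matrix M" "preserves_block_incr M"
    and v: "\<And>x. 0 \<le> v x" "\<And>x. has_mean (M x) v"
    and drift: "\<And>k i. 1 \<le> k \<Longrightarrow> expect (M (k, i)) v \<le> \<gamma> * v (k, i)"
    and D: "0 \<le> D" and f: "\<And>x. \<bar>f x\<bar> \<le> c"
    and fv: "\<And>k l i. k < l \<Longrightarrow> \<bar>f (k, i) - f (l, i)\<bar> \<le> D * v (l, i)"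
    and kl: "k < l"
  shows "\<bar>expect (M (k, i)) f - expect (M (l, i)) f\<bar> \<le> \<gamma> * D * v (l, i)"
proof -
  have main: "expect (M (l, i)) g \<le> expect (M (k, i)) g + \<gamma> * D * v (l, i)"
    if g: "\<And>x. \<bar>g x\<bar> \<le> c" and gv: "\<And>k l i. k < l \<Longrightarrow> \<bar>g (k, i) - g (l, i)\<bar> \<le> D * v (l, i)" for g
  proof -
    define \<phi> where "\<phi> x = Min ((\<lambda>a. g (a, snd x)) ` {..fst x})" for x
    have mem: "\<exists>a\<le>fst x. \<phi> x = g (a, snd x)" for x
      using Min_in[of "(\<lambda>a. g (a, snd x)) ` {..fst x}"] unfolding \<phi>_def by fastforce
    have \<phi>c: "\<bar>\<phi> x\<bar> \<le> c" for x using mem[of x] g by auto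
    have \<phi>g: "\<phi> x \<le> g x" for x
      unfolding \<phi>_def by (rule Min_le) (auto intro!: image_eqI[of _ _ "fst x"])
    \<comment> \<open>The minimum is attained at some level \<open>a\<close> not above that of
      \<open>x\<close>: either at \<open>x\<close> itself, where nonnegativity of
      \<open>D * v x\<close> suffices, or strictly below, where \<open>gv\<close> applies.\<close>
    have g\<phi>: "g x \<le> \<phi> x + D * v x" for x
    proof -
      obtain a where a: "a \<le> fst x" "\<phi> x = g (a, snd x)" using mem by blast
      show ?thesis
      proof (cases "a = fst x")
        case True
        then show ?thesis using a D v(1)[of x] by simp
      next
        case False
        then show ?thesis using a gv[of a "fst x" "snd x"] by auto
      qed
    qed
    \<comment> \<open>The minimum runs over more levels as the level of \<open>x\<close>
      grows.\<close>
    have "block_incr (\<lambda>x. - \<phi> x)"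
      unfolding \<phi>_def by (rule block_incrI) (auto intro!: Min_antimono)
    then have "block_incr (\<lambda>x. expect (M x) (\<lambda>x. - \<phi> x))"
      by (rule preserves_block_incrD[OF M(2), of _ c]) (simp add: \<phi>c)
    from block_incrD[OF this, of k l i] kl
    have dec: "expect (M (l, i)) \<phi> \<le> expect (M (k, i)) \<phi>"
      by (simp add: expect_uminus)
    note ml = stochastic_matrixD[OF M(1)]
    have "expect (M (l, i)) g \<le> expect (M (l, i)) (\<lambda>x. \<phi> x + D * v x)"
      by (rule expect_mono[OF ml has_mean_bounded[OF ml g] has_mean_add[OF
            has_mean_bounded[OF ml \<phi>c] has_mean_cmult[OF v(2)]] g\<phi>])
    also have "\<dots> = expect (M (l, i)) \<phi> + D * expect (M (l, i)) v"
      by (simp add: expect_add[OF has_mean_bounded[OF ml \<phi>c] has_mean_cmult[OF v(2)]] expect_cmult)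
    \<comment> \<open>The drift inequality is available at \<open>(l, i)\<close> because
      \<open>k < l\<close> forces l >= 1.\<close>
    also have "\<dots> \<le> expect (M (k, i)) \<phi> + D * (\<gamma> * v (l, i))"
      using dec drift[of l i] kl D by (intro add_mono mult_left_mono) auto
    also have "expect (M (k, i)) \<phi> \<le> expect (M (k, i)) g"
      by (rule expect_mono[OF ml has_mean_bounded[OF ml \<phi>c] has_mean_bounded[OF ml g] \<phi>g])
    finally show ?thesis by (simp add: mult_ac)
  qed
  \<comment> \<open>\<open>main\<close> is one-sided; applied to \<open>- f\<close> it gives the
    reverse bound.\<close>
  have "\<bar>- f (k, i) - - f (l, i)\<bar> \<le> D * v (l, i)" if "k < l" for k l i
    using fv[OF that, of i] by linarith
  then have "expect (M (l, i)) (\<lambda>x. - f x) \<le> expect (M (k, i)) (\<lambda>x. - f x) + \<gamma> * D * v (l, i)"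
    by (intro main) (simp_all add: f)
  moreover have "expect (M (l, i)) f \<le> expect (M (k, i)) f + \<gamma> * D * v (l, i)"
    by (rule main[OF f fv])
  ultimately show ?thesis unfolding expect_uminus by linarith
qed

section \<open>The truncated matrix and the phase marginal\<close>

definition clamp_level :: "nat \<Rightarrow> nat \<times> 'd \<Rightarrow> nat \<times> 'd" where
  "clamp_level n x = (min (fst x) n, snd x)"

text \<open>Column by column, both sums split at \<open>n\<close> into the levels below
  \<open>n\<close> and a tail on which the clamped function is constant. The truncated row vanishes
  above \<open>n\<close>, hence every \<open>f\<close> has a mean under it.\<close>

lemma last_column_truncation_push_forward:
  fixes P :: "nat \<times> 'd::finite \<Rightarrow> nat \<times> 'd \<Rightarrow> real"
  assumes "stochastic_matrix P"
  shows "has_mean (last_column_truncation n P x) f"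
    and "expect (last_column_truncation n P x) f = expect (P x) (\<lambda>y. f (clamp_level n y))"
proof -
  let ?Q = "last_column_truncation n P"
  define S where "S j = (\<Sum>l<n. P x (l, j) * f (l, j)) + (\<Sum>\<^sub>\<infinity>m\<in>{n..}. P x (m, j)) * f (n, j)" for j
  have Qx: "?Q x (l, j) = (if l < n then P x (l, j) else if l = n then \<Sum>\<^sub>\<infinity>m\<in>{n..}. P x (m, j) else 0)"
    for l j by (cases x) simp
  have Q: "((\<lambda>l. ?Q x (l, j) * f (l, j)) has_sum S j) UNIV" for j
  proof -
    have "((\<lambda>l. ?Q x (l, j) * f (l, j)) has_sum (\<Sum>l<Suc n. ?Q x (l, j) * f (l, j))) {..<Suc n}"
      by (rule has_sum_finite) simp
    moreover have "(\<Sum>l<Suc n. ?Q x (l, j) * f (l, j)) = S j"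
      by (simp add: Qx S_def)
    ultimately show ?thesis
      by (subst has_sum_cong_neutral[where T = "{..<Suc n}" and g = "\<lambda>l. ?Q x (l, j) * f (l, j)"])
        (auto simp: Qx)
  qed
  have P: "((\<lambda>l. P x (l, j) * f (clamp_level n (l, j))) has_sum S j) UNIV" for j
  proof -
    have "((\<lambda>l. P x (l, j) * f (clamp_level n (l, j))) has_sum (\<Sum>l<n. P x (l, j) * f (l, j))) {..<n}"
      by (rule has_sum_finiteI) (auto simp: clamp_level_def intro!: sum.cong)
    moreover have "((\<lambda>l. P x (l, j) * f (clamp_level n (l, j))) has_sum
        (\<Sum>\<^sub>\<infinity>m\<in>{n..}. P x (m, j)) * f (n, j)) {n..}"
    proof -
      have "((\<lambda>l. P x (l, j) * f (n, j)) has_sum (\<Sum>\<^sub>\<infinity>m\<in>{n..}. P x (m, j)) * f (n, j)) {n..}"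
        by (intro has_sum_cmult_left has_sum_infsum summable_on_column prob_vec_summable
            stochastic_matrixD assms)
      then show ?thesis
        by (rule has_sum_cong[THEN iffD1, rotated]) (auto simp: clamp_level_def min_def)
    qed
    ultimately have "((\<lambda>l. P x (l, j) * f (clamp_level n (l, j))) has_sum S j) ({..<n} \<union> {n..})"
      unfolding S_def by (rule has_sum_Un_disjoint) auto
    moreover have "{..<n} \<union> {n..} = UNIV" by auto
    ultimately show ?thesis by simp
  qed
  note hQ = has_sum_columns[of "\<lambda>y. ?Q x y * f y", OF Q]
  note hP = has_sum_columns[of "\<lambda>y. P x y * f (clamp_level n y)", OF P]
  show "has_mean (?Q x) f" using hQ by (rule has_sum_imp_summable)
  show "expect (?Q x) f = expect (P x) (\<lambda>y. f (clamp_level n y))"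
    unfolding expect_def using infsumI[OF hQ] infsumI[OF hP] by simp
qed

lemma stochastic_last_column_truncation:
  fixes P :: "nat \<times> 'd::finite \<Rightarrow> nat \<times> 'd \<Rightarrow> real"
  assumes "stochastic_matrix P"
  shows "stochastic_matrix (last_column_truncation n P)"
  unfolding stochastic_matrix_def
proof (intro conjI allI)
  fix x y
  show "0 \<le> last_column_truncation n P x y"
    by (cases x, cases y) (auto intro: infsum_nonneg prob_vec_nonneg stochastic_matrixD assms)
  note Q = last_column_truncation_push_forward[OF assms, where n = n and x = x and f = "\<lambda>_. 1"]
  have "(\<Sum>\<^sub>\<infinity>y. last_column_truncation n P x y) = 1"
    using Q(2) expect_const[OF stochastic_matrixD[OF assms], of x 1] by (simp add: expect_def)
  then show "(last_column_truncation n P x has_sum 1) UNIV"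
    using has_sum_infsum[OF Q(1)] by simp
qed

text \<open>Clamping preserves the order of levels, so \<open>f\<close> composed with
  \<open>clamp_level n\<close> is again block-increasing with the same bound.\<close>

lemma preserves_block_incr_last_column_truncation:
  fixes P :: "nat \<times> 'd::finite \<Rightarrow> nat \<times> 'd \<Rightarrow> real"
  assumes "stochastic_matrix P" "preserves_block_incr P"
  shows "preserves_block_incr (last_column_truncation n P)"
  unfolding preserves_block_incr_def last_column_truncation_push_forward(2)[OF assms(1)]
proof (intro allI impI)
  fix f :: "nat \<times> 'd \<Rightarrow> real" and c
  assume "block_incr f" "\<forall>x. \<bar>f x\<bar> \<le> c"
  then show "block_incr (\<lambda>x. expect (P x) (\<lambda>y. f (clamp_level n y)))"
    by (intro preserves_block_incrD[OF assms(2), of _ c] block_incrI)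
      (auto simp: clamp_level_def intro!: block_incrD)
qed

section \<open>Phase marginals of the stationary vectors\<close>

text \<open>
  The positive and the negative part of the difference \<open>c\<close> of two stationary vectors are again
  stationary, hence each of them vanishes everywhere or nowhere.
\<close>

lemma stationary_vector_unique:
  fixes Q :: "'d::finite \<Rightarrow> 'd \<Rightarrow> real"
  assumes Q: "\<And>i j. 0 \<le> Q i j" "\<And>i. (\<Sum>j\<in>UNIV. Q i j) = 1"
    and irred: "\<And>Z. (\<And>i j. i \<notin> Z \<Longrightarrow> j \<in> Z \<Longrightarrow> Q i j = 0) \<Longrightarrow> Z = {} \<or> Z = UNIV"
    and a: "\<And>j. (\<Sum>i\<in>UNIV. a i * Q i j) = a j" and b: "\<And>j. (\<Sum>i\<in>UNIV. b i * Q i j) = b j"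
    and ab: "(\<Sum>i\<in>UNIV. a i) = (\<Sum>i\<in>UNIV. b i)"
  shows "a = (b :: 'd \<Rightarrow> real)"
proof -
  define c where "c i = a i - b i" for i
  have c: "(\<Sum>i\<in>UNIV. c i * Q i j) = c j" for j
    by (simp add: c_def left_diff_distrib sum_subtractf a b)
  have c0: "(\<Sum>i\<in>UNIV. c i) = 0" by (simp add: c_def sum_subtractf ab)
  have le: "\<bar>c j\<bar> \<le> (\<Sum>i\<in>UNIV. \<bar>c i\<bar> * Q i j)" for j
  proof -
    have "\<bar>c j\<bar> \<le> (\<Sum>i\<in>UNIV. \<bar>c i * Q i j\<bar>)" by (subst c[symmetric]) (rule sum_abs)
    then show ?thesis by (simp add: abs_mult Q)
  qed
  \<comment> \<open>The rows of \<open>Q\<close> sum to 1, so both sides of \<open>le\<close> have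
    equal totals and the inequality must be an equality: the absolute value of \<open>c\<close> is
    stationary too.\<close>
  have "(\<Sum>j\<in>UNIV. \<Sum>i\<in>UNIV. \<bar>c i\<bar> * Q i j) = (\<Sum>j\<in>UNIV. \<bar>c j\<bar>)"
    by (subst sum.swap) (simp add: sum_distrib_left[symmetric] Q)
  then have abs: "(\<Sum>i\<in>UNIV. \<bar>c i\<bar> * Q i j) = \<bar>c j\<bar>" for j
    using sum_mono_inv[of "\<lambda>j. \<bar>c j\<bar>" UNIV "\<lambda>j. \<Sum>i\<in>UNIV. \<bar>c i\<bar> * Q i j" j] le by simp
  have zero: "{i. f i = 0} = {} \<or> {i. f i = 0} = UNIV"
    if f: "\<And>i. 0 \<le> f i" "\<And>j. (\<Sum>i\<in>UNIV. f i * Q i j) = f j" for f :: "'d \<Rightarrow> real"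
  proof (rule irred)
    fix i j assume ij: "i \<notin> {i. f i = 0}" "j \<in> {i. f i = 0}"
    then have "(\<Sum>i\<in>UNIV. f i * Q i j) = 0" using f(2)[of j] by simp
    then have "f i * Q i j = 0"
      by (subst (asm) sum_nonneg_eq_0_iff) (auto simp: f Q)
    then show "Q i j = 0" using ij by simp
  qed
  \<comment> \<open>These two combinations are twice the positive and the negative part of
    \<open>c\<close>.\<close>
  have p: "{i. \<bar>c i\<bar> + c i = 0} = {} \<or> {i. \<bar>c i\<bar> + c i = 0} = UNIV"
    by (rule zero) (simp_all add: distrib_right sum.distrib c abs)
  have q: "{i. \<bar>c i\<bar> - c i = 0} = {} \<or> {i. \<bar>c i\<bar> - c i = 0} = UNIV"
    by (rule zero) (simp_all add: left_diff_distrib sum_subtractf c abs)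
  have "c i = 0" for i
  proof -
    \<comment> \<open>Each index lies in one of the two zero sets, so one of them is nonempty and
      hence everything: \<open>c\<close> has constant sign, and its sum is 0.\<close>
    have "\<bar>c i\<bar> + c i = 0 \<or> \<bar>c i\<bar> - c i = 0" by linarith
    then have "i \<in> {i. \<bar>c i\<bar> + c i = 0} \<or> i \<in> {i. \<bar>c i\<bar> - c i = 0}"
      by (simp only: mem_Collect_eq)
    then have "{i. \<bar>c i\<bar> + c i = 0} = UNIV \<or> {i. \<bar>c i\<bar> - c i = 0} = UNIV"
      using p q by (metis empty_iff)
    then have sgn: "(\<forall>i. \<bar>c i\<bar> + c i = 0) \<or> (\<forall>i. \<bar>c i\<bar> - c i = 0)"
      by (simp only: set_eq_iff mem_Collect_eq UNIV_I simp_thms)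
    from sgn show "c i = 0"
    proof
      assume neg: "\<forall>i. \<bar>c i\<bar> + c i = 0"
      have "0 \<le> - c j" for j using spec[OF neg, of j] by linarith
      then show ?thesis using sum_nonneg_0[of UNIV "\<lambda>i. - c i" i] c0 by (simp add: sum_negf)
    next
      assume pos: "\<forall>i. \<bar>c i\<bar> - c i = 0"
      have "0 \<le> c j" for j using spec[OF pos, of j] by linarith
      then show ?thesis using sum_nonneg_0[of UNIV c i] c0 by simp
    qed
  qed
  then show ?thesis by (auto simp: c_def)
qed

lemma expect_sum:
  assumes "finite I" "\<And>i. i \<in> I \<Longrightarrow> has_mean p (f i)"
  shows "has_mean p (\<lambda>x. \<Sum>i\<in>I. f i x) \<and> expect p (\<lambda>x. \<Sum>i\<in>I. f i x) = (\<Sum>i\<in>I. expect p (f i))"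
  using assms
proof (induction I rule: finite_induct)
  case empty
  then show ?case by (simp add: expect_def)
next
  case (insert i I)
  then show ?case
    using has_mean_add[of p "f i" "\<lambda>x. \<Sum>i\<in>I. f i x"] expect_add[of p "f i" "\<lambda>x. \<Sum>i\<in>I. f i x"] by simp
qed

lemma expect_phase_sum:
  fixes p :: "nat \<times> 'd::finite \<Rightarrow> real"
  assumes "prob_vec p"
  shows "expect p (\<lambda>x. \<psi> (snd x)) = (\<Sum>i\<in>UNIV. expect p (\<lambda>x. of_bool (snd x = i)) * \<psi> i)"
proof -
  have m: "has_mean p (\<lambda>x. \<psi> i * of_bool (snd x = i))" for i
    by (rule has_mean_bounded[OF assms, of _ "\<bar>\<psi> i\<bar>"]) (simp add: of_bool_def)
  have "\<psi> (snd x) = (\<Sum>i\<in>UNIV. \<psi> i * of_bool (snd x = i))" for x :: "nat \<times> 'd"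
    by (simp add: of_bool_def sum.delta if_distrib cong: if_cong)
  then have "expect p (\<lambda>x. \<psi> (snd x)) = expect p (\<lambda>x. \<Sum>i\<in>UNIV. \<psi> i * of_bool (snd x = i))"
    by presburger
  also have "\<dots> = (\<Sum>i\<in>UNIV. expect p (\<lambda>x. \<psi> i * of_bool (snd x = i)))"
    using expect_sum[of UNIV p "\<lambda>i x. \<psi> i * of_bool (snd x = i)"] m by auto
  finally show ?thesis by (simp only: expect_cmult mult.commute)
qed

text \<open>A set of phases that cannot be entered from outside in one step cannot be entered in any
  number of steps, whatever the levels.\<close>

lemma irreducible_matrix_closed_phases:
  fixes P :: "nat \<times> 'd \<Rightarrow> nat \<times> 'd \<Rightarrow> real"
  assumes irr: "irreducible_matrix P"
    and Z: "\<And>k i l j. i \<notin> Z \<Longrightarrow> j \<in> Z \<Longrightarrow> P (k, i) (l, j) = 0"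
  shows "Z = {} \<or> Z = UNIV"
proof (rule ccontr)
  assume "\<not> ?thesis"
  then obtain i j where ij: "i \<notin> Z" "j \<in> Z" by blast
  have "\<forall>x. snd x \<notin> Z \<longrightarrow> matrix_power P n x (0, j) = 0" for n
  proof (induction n)
    case 0
    then show ?case using ij by auto
  next
    case (Suc n)
    show ?case
    proof (intro allI impI)
      fix x :: "nat \<times> 'd" assume x: "snd x \<notin> Z"
      have "P x z * matrix_power P n z (0, j) = 0" for z
        using x Z[of "snd x" "snd z" "fst x" "fst z"] Suc[THEN spec, of z] by (cases "snd z \<in> Z") simp_all
      then show "matrix_power P (Suc n) x (0, j) = 0"
        unfolding matrix_power.simps by (intro infsum_0)
    qed
  qed
  then have "\<not> (\<exists>n. 0 < matrix_power P n (0, i) (0, j))" using ij by simp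
  then show False using irr unfolding irreducible_matrix_def by blast
qed

text \<open>
  The phases form a Markov chain of their own, with an irreducible transition matrix which
  truncation does not change; hence both stationary vectors have the same phase marginal.
\<close>

lemma stationary_phase_marginal_eq:
  fixes P :: "nat \<times> 'd::finite \<Rightarrow> nat \<times> 'd \<Rightarrow> real"
  assumes P: "stochastic_matrix P" "preserves_block_incr P" "irreducible_matrix P"
    and p: "stationary_prob P p" and q: "stationary_prob (last_column_truncation n P) q"
  shows "expect p (\<lambda>x. \<psi> (snd x)) = expect q (\<lambda>x. \<psi> (snd x))"
proof -
  let ?I = "\<lambda>j x :: nat \<times> 'd. of_bool (snd x = j) :: real"
  define Q where "Q i j = expect (P (0, i)) (?I j)" for i j
  note pp = stationary_prob_prob_vec[OF p] and pq = stationary_prob_prob_vec[OF q]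
  have I1: "\<bar>?I j x\<bar> \<le> 1" for j x by simp
  have PQ: "expect (P x) (?I j) = Q (snd x) j" for x j
    unfolding Q_def using expect_phase_function[OF P(2), of "fst x" "snd x" "\<lambda>i. of_bool (i = j)"]
    by simp
  have one: "(\<Sum>j\<in>UNIV. expect r (?I j)) = 1" if "prob_vec r" for r
    using expect_phase_sum[OF that, of "\<lambda>_. 1"] expect_const[OF that, of 1] by simp
  have "(\<lambda>j. expect p (?I j)) = (\<lambda>j. expect q (?I j))"
  proof (rule stationary_vector_unique[of Q])
    show "0 \<le> Q i j" for i j
      unfolding Q_def by (intro expect_nonneg stochastic_matrixD P) auto
    show "(\<Sum>j\<in>UNIV. Q i j) = 1" for i
      unfolding Q_def by (intro one stochastic_matrixD P)
    show "Z = {} \<or> Z = UNIV" if Z: "\<And>i j. i \<notin> Z \<Longrightarrow> j \<in> Z \<Longrightarrow> Q i j = 0" for Z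
    proof (rule irreducible_matrix_closed_phases[OF P(3)])
      fix k i l j assume ij: "i \<notin> Z" "j \<in> Z"
      note px = stochastic_matrixD[OF P(1), of "(k, i)"]
      \<comment> \<open>A vanishing \<open>Q i j\<close> is a vanishing sum of nonnegative entries
        of \<open>P\<close>, for every starting level \<open>k\<close> by \<open>PQ\<close>.\<close>
      have "(\<Sum>\<^sub>\<infinity>y. P (k, i) y * ?I j y) = 0"
        using PQ[of "(k, i)" j] Z[OF ij] by (simp add: expect_def)
      from nonneg_infsum_le_0D[OF eq_refl[OF this] has_mean_bounded[OF px I1], of "(l, j)"]
      show "P (k, i) (l, j) = 0"
        by (simp add: prob_vec_nonneg[OF px])
    qed
    show "(\<Sum>i\<in>UNIV. expect p (?I i) * Q i j) = expect p (?I j)" for j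
      using expect_stationary[OF P(1) p, of "?I j" 1] expect_phase_sum[OF pp, of "\<lambda>i. Q i j"]
      by (simp add: PQ)
    \<comment> \<open>Clamping changes only the level, so truncation leaves the phase matrix
      \<open>Q\<close> intact.\<close>
    have "expect (last_column_truncation n P x) (?I j) = Q (snd x) j" for x j
      by (simp add: last_column_truncation_push_forward(2)[OF P(1)] clamp_level_def PQ)
    then show "(\<Sum>i\<in>UNIV. expect q (?I i) * Q i j) = expect q (?I j)" for j
      using expect_stationary[OF stochastic_last_column_truncation[OF P(1)] q, of "?I j" 1]
        expect_phase_sum[OF pq, of "\<lambda>i. Q i j"]
      by simp
    show "(\<Sum>i\<in>UNIV. expect p (?I i)) = (\<Sum>i\<in>UNIV. expect q (?I i))"
      by (simp add: one pp pq)
  qed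
  then show ?thesis
    by (simp add: expect_phase_sum[OF pp, of \<psi>] expect_phase_sum[OF pq, of \<psi>] fun_eq_iff)
qed

section \<open>The error bound under a geometric drift condition\<close>

text \<open>Powers act on functions here, so bounds and monotonicity pass through the iteration
  without products of infinite matrices.\<close>

definition apply_power :: "('s \<Rightarrow> 's \<Rightarrow> real) \<Rightarrow> nat \<Rightarrow> ('s \<Rightarrow> real) \<Rightarrow> 's \<Rightarrow> real" where
  "apply_power M m = ((\<lambda>f x. expect (M x) f) ^^ m)"

lemma apply_power_0 [simp]: "apply_power M 0 f = f"
  by (simp add: apply_power_def)

lemma apply_power_Suc [simp]:
  "apply_power M (Suc m) f = (\<lambda>x. expect (M x) (apply_power M m f))"
  by (simp add: apply_power_def)

lemma apply_power_bounded:
  assumes "stochastic_matrix M" "\<And>x. \<bar>f x\<bar> \<le> c"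
  shows "\<bar>apply_power M m f x\<bar> \<le> c"
  by (induction m arbitrary: x) (auto intro!: assms expect_abs_le_const stochastic_matrixD)

lemma apply_power_block_incr:
  assumes "stochastic_matrix M" "preserves_block_incr M" "block_incr f" "\<And>x. \<bar>f x\<bar> \<le> c"
  shows "block_incr (apply_power M m f)"
  by (induction m)
    (auto intro!: assms preserves_block_incrD[where c = c] apply_power_bounded)

lemma expect_apply_power_stationary:
  assumes "stochastic_matrix M" "stationary_prob M p" "\<And>x. \<bar>f x\<bar> \<le> c"
  shows "expect p (apply_power M m f) = expect p f"
proof (induction m)
  case (Suc m)
  then show ?case
    using expect_stationary[OF assms(1,2) apply_power_bounded[OF assms(1,3)]] by simp
qed simp

text \<open>\<open>drift_contraction\<close> is iterated with \<open>D = 2 * \<gamma> ^ m\<close>;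
  the initial value 2 comes from the bound 1 on \<open>g\<close> together with v >= 1.\<close>

lemma apply_power_contraction:
  fixes M :: "nat \<times> 'd::finite \<Rightarrow> nat \<times> 'd \<Rightarrow> real"
  assumes M: "stochastic_matrix M" "preserves_block_incr M"
    and v: "\<And>x. 1 \<le> v x" "\<And>x. has_mean (M x) v"
    and drift: "\<And>k i. 1 \<le> k \<Longrightarrow> expect (M (k, i)) v \<le> \<gamma> * v (k, i)"
    and \<gamma>: "0 \<le> \<gamma>" and g: "\<And>x. \<bar>g x\<bar> \<le> 1" and kl: "k < l"
  shows "\<bar>apply_power M m g (k, i) - apply_power M m g (l, i)\<bar> \<le> 2 * \<gamma> ^ m * v (l, i)"
  using kl
proof (induction m arbitrary: k l i)
  case 0
  then show ?case using g[of "(k, i)"] g[of "(l, i)"] v(1)[of "(l, i)"] by simp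
next
  case (Suc m)
  have v0: "0 \<le> v x" for x using v(1)[of x] by simp
  have "\<bar>expect (M (k, i)) (apply_power M m g) - expect (M (l, i)) (apply_power M m g)\<bar>
      \<le> \<gamma> * (2 * \<gamma> ^ m) * v (l, i)"
    by (rule drift_contraction[OF M v0 v(2) drift _ apply_power_bounded[OF M(1) g] Suc.IH Suc.prems])
      (use \<gamma> in auto)
  then show ?case by (simp add: mult_ac)
qed

text \<open>Invariance replaces \<open>g\<close> by its m-th iterate under \<open>p\<close>. Moving
  each starting state down to level 0 in the same phase then costs at most the contraction bound,
  averaged over \<open>p\<close>.\<close>

lemma convergence_from_level_0:
  fixes M :: "nat \<times> 'd::finite \<Rightarrow> nat \<times> 'd \<Rightarrow> real"
  assumes M: "stochastic_matrix M" "preserves_block_incr M" and p: "stationary_prob M p"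
    and v: "\<And>x. 1 \<le> v x" "\<And>x. has_mean (M x) v" "has_mean p v"
    and drift: "\<And>k i. 1 \<le> k \<Longrightarrow> expect (M (k, i)) v \<le> \<gamma> * v (k, i)"
    and \<gamma>: "0 \<le> \<gamma>" and g: "\<And>x. \<bar>g x\<bar> \<le> 1"
  shows "\<bar>expect p g - expect p (\<lambda>x. apply_power M m g (0, snd x))\<bar> \<le> 2 * \<gamma> ^ m * expect p v"
proof -
  note pv = stationary_prob_prob_vec[OF p]
  have "expect p g - expect p (\<lambda>x. apply_power M m g (0, snd x))
      = expect p (\<lambda>x. apply_power M m g x - apply_power M m g (0, snd x))"
    using expect_diff[OF has_mean_bounded[OF pv apply_power_bounded[OF M(1) g, of m]]
        has_mean_bounded[OF pv, of "\<lambda>x. apply_power M m g (0, snd x)", OF apply_power_bounded[OF M(1) g]]]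
      expect_apply_power_stationary[OF M(1) p g, of m] by simp
  also have "\<bar>\<dots>\<bar> \<le> expect p (\<lambda>x. 2 * \<gamma> ^ m * v x)"
  proof (rule expect_abs_le[OF pv has_mean_cmult[OF v(3)]])
    fix x :: "nat \<times> 'd"
    obtain k i where x: "x = (k, i)" by (cases x)
    show "\<bar>apply_power M m g x - apply_power M m g (0, snd x)\<bar> \<le> 2 * \<gamma> ^ m * v x"
    proof (cases "k = 0")
      case True
      then show ?thesis using \<gamma> v(1)[of x] by (simp add: x)
    next
      case False
      then show ?thesis
        using apply_power_contraction[OF M v(1,2) drift \<gamma> g, where k = 0 and l = k and m = m and i = i]
        by (simp add: x abs_minus_commute)
    qed
  qed
  finally show ?thesis by (simp add: expect_cmult)
qed

section \<open>Comparison of the iterates of the full and the truncated matrix\<close>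

definition overshoot :: "('s \<Rightarrow> nat \<times> 'd \<Rightarrow> real) \<Rightarrow> nat \<Rightarrow> 's \<Rightarrow> real" where
  "overshoot P n x = expect (P x) (\<lambda>y. of_bool (n < fst y))"

lemma overshoot_bounded: "stochastic_matrix P \<Longrightarrow> \<bar>overshoot P n x\<bar> \<le> 1"
  unfolding overshoot_def by (rule expect_abs_le_const[OF stochastic_matrixD]) auto

text \<open>With Q the truncated matrix, P^(m+1) - Q^(m+1) = P (P^m - Q^m) + (P - Q) Q^m. Induction
  handles the first part; the second sees only jumps above level \<open>n\<close>, each costing at
  most 2.\<close>

lemma truncation_perturbation:
  fixes P :: "nat \<times> 'd::finite \<Rightarrow> nat \<times> 'd \<Rightarrow> real"
  assumes P: "stochastic_matrix P" and g: "\<And>x. \<bar>g x\<bar> \<le> 1"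
  shows "\<bar>apply_power P m g x - apply_power (last_column_truncation n P) m g x\<bar>
    \<le> 2 * (\<Sum>h<m. apply_power P h (overshoot P n) x)"
proof (induction m arbitrary: x)
  case (Suc m)
  let ?Q = "last_column_truncation n P" and ?T = "overshoot P n"
  let ?p = "apply_power P m g" and ?q = "apply_power ?Q m g"
  note px = stochastic_matrixD[OF P]
  have mp: "has_mean (P x) ?p" and mq: "has_mean (P x) ?q"
    and mqc: "has_mean (P x) (\<lambda>y. ?q (clamp_level n y))"
    by (rule has_mean_bounded[OF px apply_power_bounded[OF _ g]],
        rule P stochastic_last_column_truncation[OF P])+
  have mt: "has_mean (P x) (\<lambda>y. apply_power P h ?T y)" for h
    by (rule has_mean_bounded[OF px apply_power_bounded[OF P overshoot_bounded[OF P]]])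
  have mi: "has_mean (P x) (\<lambda>y. of_bool (n < fst y))"
    by (rule has_mean_bounded[OF px, of _ 1]) simp
  have "apply_power P (Suc m) g x - apply_power ?Q (Suc m) g x
      = expect (P x) (\<lambda>y. ?p y - ?q y) + expect (P x) (\<lambda>y. ?q y - ?q (clamp_level n y))"
    by (simp add: last_column_truncation_push_forward(2)[OF P] expect_diff mp mq mqc)
  moreover have "\<bar>expect (P x) (\<lambda>y. ?p y - ?q y)\<bar>
      \<le> expect (P x) (\<lambda>y. 2 * (\<Sum>h<m. apply_power P h ?T y))"
    using expect_sum[of "{..<m}" "P x" "\<lambda>h. apply_power P h ?T"] mt
    by (intro expect_abs_le px has_mean_cmult Suc.IH) auto
  moreover have "expect (P x) (\<lambda>y. 2 * (\<Sum>h<m. apply_power P h ?T y))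
      = 2 * (\<Sum>h<m. apply_power P (Suc h) ?T x)"
    using expect_sum[of "{..<m}" "P x" "\<lambda>h. apply_power P h ?T"] mt by (simp add: expect_cmult)
  moreover have "\<bar>expect (P x) (\<lambda>y. ?q y - ?q (clamp_level n y))\<bar>
      \<le> expect (P x) (\<lambda>y. 2 * of_bool (n < fst y))"
  proof (rule expect_abs_le[OF px has_mean_cmult[OF mi]])
    fix y :: "nat \<times> 'd"
    have b: "\<bar>?q z\<bar> \<le> 1" for z
      by (rule apply_power_bounded[OF stochastic_last_column_truncation[OF P] g])
    show "\<bar>?q y - ?q (clamp_level n y)\<bar> \<le> 2 * of_bool (n < fst y)"
      using b[of y] b[of "clamp_level n y"] by (cases y) (auto simp: clamp_level_def min_def)
  qed
  moreover have "expect (P x) (\<lambda>y. 2 * of_bool (n < fst y)) = 2 * ?T x"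
    by (simp add: expect_cmult overshoot_def)
  \<comment> \<open>Applying \<open>P\<close> to the induction bound raises each exponent by one and
    leaves h = 0 for the new overshoot.\<close>
  moreover have "(\<Sum>h<Suc m. apply_power P h ?T x) = ?T x + (\<Sum>h<m. apply_power P (Suc h) ?T x)"
    by (subst sum.lessThan_Suc_shift) simp
  ultimately show ?case by linarith
qed simp

text \<open>The iterates of the overshoot are block-increasing, so lowering the start to level 0 can
  only decrease them. Stationarity then removes all h + 1 transitions.\<close>

lemma expect_overshoot_from_level_0:
  fixes P :: "nat \<times> 'd::finite \<Rightarrow> nat \<times> 'd \<Rightarrow> real"
  assumes P: "stochastic_matrix P" "preserves_block_incr P" and p: "stationary_prob P p"
  shows "expect p (\<lambda>x. apply_power P h (overshoot P n) (0, snd x)) \<le> expect p (\<lambda>y. of_bool (n < fst y))"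
proof -
  note pv = stationary_prob_prob_vec[OF p] and T = overshoot_bounded[OF P(1), of n]
  have "block_incr (overshoot P n)"
    unfolding overshoot_def
    by (rule preserves_block_incrD[OF P(2), of _ 1]) (auto intro!: block_incrI)
  then have inc: "block_incr (apply_power P h (overshoot P n))"
    by (rule apply_power_block_incr[OF P _ T])
  have "expect p (\<lambda>x. apply_power P h (overshoot P n) (0, snd x))
      \<le> expect p (apply_power P h (overshoot P n))"
    by (rule expect_mono[OF pv has_mean_bounded[OF pv apply_power_bounded[OF P(1) T]]
          has_mean_bounded[OF pv apply_power_bounded[OF P(1) T]]])
      (metis block_incrD[OF inc] le0 prod.collapse)
  also have "\<dots> = expect p (overshoot P n)"
    by (rule expect_apply_power_stationary[OF P(1) p T])
  also have "\<dots> = expect p (\<lambda>y. of_bool (n < fst y))"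
    unfolding overshoot_def by (rule expect_stationary[OF P(1) p, of _ 1]) simp
  finally show ?thesis .
qed

section \<open>Assembly of the error bound\<close>

theorem truncation_error_bound:
  fixes P :: "nat \<times> 'd::finite \<Rightarrow> nat \<times> 'd \<Rightarrow> real"
  assumes P: "stochastic_matrix P" "block_monotone P" "irreducible_matrix P"
    and p: "stationary_prob P p" and q: "stationary_prob (last_column_truncation n P) q"
    and v: "\<And>x. 1 \<le> v x" "block_incr v" "\<And>x. has_mean (P x) v"
    and drift: "\<And>k i. expect (P (k, i)) v \<le> \<gamma> * v (k, i) + (if k = 0 then b else 0)"
    and \<gamma>: "0 \<le> \<gamma>" "\<gamma> < 1" and b: "0 \<le> b"
  shows "l1_norm (\<lambda>x. q x - p x)
    \<le> b / (1 - \<gamma>) * (4 * \<gamma> ^ m + 2 * real m * (\<Sum>i\<in>UNIV. 1 / v (n, i)))"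
proof -
  let ?Q = "last_column_truncation n P" and ?over = "\<lambda>y :: nat \<times> 'd. of_bool (n < fst y) :: real"
  have PI: "preserves_block_incr P"
    by (rule block_monotone_preserves_block_incr[OF P(1,2)])
  note Q = stochastic_last_column_truncation[OF P(1), of n]
    preserves_block_incr_last_column_truncation[OF P(1) PI, of n]
  note pp = stationary_prob_prob_vec[OF p] and pq = stationary_prob_prob_vec[OF q]
  have v0: "0 \<le> v x" for x using v(1)[of x] by simp
  have mQ: "has_mean (?Q x) v" for x
    by (rule last_column_truncation_push_forward(1)[OF P(1)])
  \<comment> \<open>Clamping can only lower \<open>v\<close>, so the truncated chain inherits the
    drift inequality with the same constants.\<close>
  have vcl: "v (clamp_level n y) \<le> v y" for y
    by (cases y) (auto simp: clamp_level_def intro: block_incrD[OF v(2)])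
  have QP: "expect (?Q x) v \<le> expect (P x) v" for x
    unfolding last_column_truncation_push_forward(2)[OF P(1)]
    by (rule expect_mono[OF stochastic_matrixD[OF P(1)] has_mean_le[OF
            stochastic_matrixD[OF P(1)] v(3)] v(3)])
      (auto simp: vcl v0)
  have driftQ: "expect (?Q (k, i)) v \<le> \<gamma> * v (k, i) + (if k = 0 then b else 0)" for k i
    using QP drift by (rule order_trans)
  have drift': "expect (P x) v \<le> \<gamma> * v x + b" and driftQ': "expect (?Q x) v \<le> \<gamma> * v x + b" for x
    using drift[of "fst x" "snd x"] driftQ[of "fst x" "snd x"] b by (auto split: if_splits)
  have drift1: "expect (P (k, i)) v \<le> \<gamma> * v (k, i)" and driftQ1: "expect (?Q (k, i)) v \<le> \<gamma> * v (k, i)"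
    if "1 \<le> k" for k i using drift[of k i] driftQ[of k i] that by auto
  note vp = stationary_drift_bound[OF P(1) p v0 v(3) drift' \<gamma> b]
    and vq = stationary_drift_bound[OF Q(1) q v0 mQ driftQ' \<gamma> b]
  define C where "C = b / (1 - \<gamma>)"
  \<comment> \<open>Testing against the sign of the difference turns the norm into a difference of
    two means.\<close>
  define g where "g x = sgn (q x - p x)" for x
  have g: "\<bar>g x\<bar> \<le> 1" for x by (simp add: g_def sgn_real_def)
  have "l1_norm (\<lambda>x. q x - p x) = (\<Sum>\<^sub>\<infinity>x. q x * g x - p x * g x)"
    unfolding l1_norm_def g_def by (simp add: left_diff_distrib[symmetric] abs_sgn)
  also have "\<dots> = expect q g - expect p g"
    unfolding expect_def
    using infsum_add[OF has_mean_bounded[OF pq g] summable_on_uminus[THEN iffD2, OF has_mean_bounded[OF pp g]]]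
    by (simp add: infsum_uminus)
  finally have norm: "l1_norm (\<lambda>x. q x - p x) = expect q g - expect p g" .
  let ?f = "\<lambda>x. apply_power P m g (0, snd x)" and ?fq = "\<lambda>x. apply_power ?Q m g (0, snd x)"
  have 1: "\<bar>expect p g - expect p ?f\<bar> \<le> 2 * \<gamma> ^ m * expect p v"
    by (rule convergence_from_level_0[OF P(1) PI p v(1,3) vp(1) drift1 \<gamma>(1) g])
  have 2: "\<bar>expect q g - expect q ?fq\<bar> \<le> 2 * \<gamma> ^ m * expect q v"
    by (rule convergence_from_level_0[OF Q q v(1) mQ vq(1) driftQ1 \<gamma>(1) g])
  \<comment> \<open>The integrand depends on the phase alone, so equality of the phase marginals
    lets \<open>p\<close> replace \<open>q\<close>.\<close>
  have 3: "expect q ?fq = expect p ?fq"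
    using stationary_phase_marginal_eq[OF P(1) PI P(3) p q, of "\<lambda>i. apply_power ?Q m g (0, i)"] by simp
  have mT: "has_mean p (\<lambda>x. apply_power P h (overshoot P n) (0, snd x))" for h
    by (rule has_mean_bounded[OF pp apply_power_bounded[OF P(1) overshoot_bounded[OF P(1)]]])
  have "\<bar>expect p (\<lambda>x. ?f x - ?fq x)\<bar>
      \<le> expect p (\<lambda>x. 2 * (\<Sum>h<m. apply_power P h (overshoot P n) (0, snd x)))"
    using expect_sum[of "{..<m}" p "\<lambda>h x. apply_power P h (overshoot P n) (0, snd x)"] mT
    by (intro expect_abs_le pp has_mean_cmult truncation_perturbation[OF P(1) g]) auto
  also have "\<dots> = 2 * (\<Sum>h<m. expect p (\<lambda>x. apply_power P h (overshoot P n) (0, snd x)))"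
    using expect_sum[of "{..<m}" p "\<lambda>h x. apply_power P h (overshoot P n) (0, snd x)"] mT
    by (simp add: expect_cmult)
  also have "\<dots> \<le> 2 * (\<Sum>h<m. expect p ?over)"
    by (intro mult_left_mono sum_mono expect_overshoot_from_level_0[OF P(1) PI p]) auto
  finally have "\<bar>expect p (\<lambda>x. ?f x - ?fq x)\<bar> \<le> 2 * real m * expect p ?over" by simp
  moreover have "expect p (\<lambda>x. ?f x - ?fq x) = expect p ?f - expect p ?fq"
    by (rule expect_diff[OF has_mean_bounded[OF pp apply_power_bounded[OF P(1) g]]
          has_mean_bounded[OF pp apply_power_bounded[OF Q(1) g]]])
  ultimately have 4: "\<bar>expect p ?f - expect p ?fq\<bar> \<le> 2 * real m * expect p ?over" by simp
  \<comment> \<open>Markov's inequality phase by phase: above level \<open>n\<close> in phase i,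
    \<open>v\<close> is at least \<open>v (n, i)\<close>, and \<open>S\<close> dominates each
    reciprocal.\<close>
  define S where "S = (\<Sum>i\<in>UNIV. 1 / v (n, i))"
  have "expect p ?over \<le> expect p (\<lambda>x. S * v x)"
  proof (rule expect_mono[OF pp has_mean_bounded[OF pp, of _ 1] has_mean_cmult[OF vp(1)]])
    fix x :: "nat \<times> 'd"
    show "?over x \<le> S * v x"
    proof (cases "n < fst x")
      case True
      have "1 / v (n, snd x) \<le> S"
        unfolding S_def using v0 by (intro member_le_sum) auto
      moreover have "v (n, snd x) \<le> v x"
        using block_incrD[OF v(2), of n "fst x" "snd x"] True by simp
      ultimately have "1 / v (n, snd x) * v (n, snd x) \<le> S * v x"
        using v0 order_trans[OF _ \<open>1 / v (n, snd x) \<le> S\<close>, of 0] by (intro mult_mono) auto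
      then show ?thesis using v(1)[of "(n, snd x)"] True by simp
    qed (auto simp: S_def intro!: mult_nonneg_nonneg sum_nonneg v0)
  qed simp
  then have over: "expect p ?over \<le> S * C"
    using vp(2) mult_left_mono[of "expect p v" C S] v0
    by (force simp: C_def S_def expect_cmult intro: sum_nonneg)
  have "l1_norm (\<lambda>x. q x - p x) \<le> 2 * \<gamma> ^ m * expect q v + 2 * real m * expect p ?over + 2 * \<gamma> ^ m * expect p v"
    using 1 2 3 4 unfolding norm by linarith
  also have "\<dots> \<le> 2 * \<gamma> ^ m * C + 2 * real m * (S * C) + 2 * \<gamma> ^ m * C"
    using vp(2) vq(2) over \<gamma> by (intro add_mono mult_left_mono) (auto simp: C_def)
  finally show ?thesis unfolding C_def[symmetric] S_def[symmetric] by (simp add: algebra_simps)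
qed

section \<open>The drift condition for GI/G/1-type matrices\<close>

lemma has_sum_vecI:
  fixes f :: "'a \<Rightarrow> 'b::real_normed_vector ^ 'd"
  assumes "\<And>i. ((\<lambda>x. f x $ i) has_sum S $ i) A"
  shows "(f has_sum S) A"
  using assms unfolding has_sum_def by (intro vec_tendstoI) (simp add: sum_component)

text \<open>Links the vector series in \<open>w_vec\<close> to a mean under a row of
  \<open>P\<close>. Columnwise summability ensures that neither infinite sum falls back to its
  default value 0.\<close>

lemma w_vec_nth:
  fixes P :: "nat \<times> 'd::finite \<Rightarrow> nat \<times> 'd \<Rightarrow> real"
  assumes col: "\<And>i j. (\<lambda>l. P (k, i) (l, j) * (\<alpha> ^ l * u $ j)) summable_on UNIV"
  shows "has_mean (P (k, i)) (\<lambda>x. \<alpha> ^ fst x * u $ snd x)"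
    and "w_vec P \<alpha> u k $ i = expect (P (k, i)) (\<lambda>x. \<alpha> ^ fst x * u $ snd x)"
proof -
  let ?S = "\<lambda>i. \<Sum>j\<in>UNIV. \<Sum>\<^sub>\<infinity>l. P (k, i) (l, j) * (\<alpha> ^ l * u $ j)"
  have S: "((\<lambda>x. P (k, i) x * (\<alpha> ^ fst x * u $ snd x)) has_sum ?S i) UNIV" for i
    by (rule has_sum_columns) (use has_sum_infsum[OF col] in simp)
  show "has_mean (P (k, i)) (\<lambda>x. \<alpha> ^ fst x * u $ snd x)"
    using S by (rule has_sum_imp_summable)
  have "((\<lambda>l. block P k l *v (\<alpha> ^ l *\<^sub>R u)) has_sum (\<chi> i. ?S i)) UNIV"
  proof (rule has_sum_vecI)
    fix i
    have "((\<lambda>l. \<Sum>j\<in>UNIV. P (k, i) (l, j) * (\<alpha> ^ l * u $ j)) has_sum ?S i) UNIV"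
      by (rule has_sum_finite_sum) (auto intro: has_sum_infsum col)
    then show "((\<lambda>l. (block P k l *v (\<alpha> ^ l *\<^sub>R u)) $ i) has_sum (\<chi> i. ?S i) $ i) UNIV"
      by (simp add: matrix_vector_mult_def block_def)
  qed
  then show "w_vec P \<alpha> u k $ i = expect (P (k, i)) (\<lambda>x. \<alpha> ^ fst x * u $ snd x)"
    unfolding w_vec_def expect_def using infsumI[OF S[of i]] by (simp add: infsumI)
qed

lemma GI_G_1_form_nth:
  assumes "GI_G_1_form P A B"
  shows "P (0, i) (l, j) = B (int l) $ i $ j"
    and "k \<ge> 1 \<Longrightarrow> P (k, i) (0, j) = B (- int k) $ i $ j"
    and "k \<ge> 1 \<Longrightarrow> l \<ge> 1 \<Longrightarrow> P (k, i) (l, j) = A (int l - int k) $ i $ j"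
  using assms unfolding GI_G_1_form_def block_def by (auto simp: vec_eq_iff)

text \<open>From a level k >= 1 the column is a shift of the entries of \<open>A\<close>, which
  \<open>r_plus\<close> controls. The row of level 0 consists of blocks of \<open>B\<close>;
  block-monotonicity bounds its tails by those of the row of level 1.\<close>

lemma GI_G_1_column_summable:
  fixes P :: "nat \<times> 'd::finite \<Rightarrow> nat \<times> 'd \<Rightarrow> real"
  assumes P: "stochastic_matrix P" "GI_G_1_form P A B" "block_monotone P"
    and \<alpha>: "1 \<le> \<alpha>" "ereal \<alpha> < r_plus A"
  shows "(\<lambda>l. P (k, i) (l, j) * \<alpha> ^ l) summable_on UNIV"
proof -
  have P0: "0 \<le> P x y" for x y
    by (rule prob_vec_nonneg[OF stochastic_matrixD[OF P(1)]])
  have A: "A (int l) $ i $ j = P (k, i) (l + k, j)" if "k \<ge> 1" for k l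
    using that by (simp add: GI_G_1_form_nth(3)[OF P(2)])
  \<comment> \<open>Since \<alpha> lies strictly below the supremum, some larger \<open>z\<close>
    has a convergent series.\<close>
  obtain z where z: "\<alpha> < z" "(\<lambda>k::nat. z ^ k *\<^sub>R A (int k)) summable_on UNIV"
    using \<alpha>(2) unfolding r_plus_def less_Sup_iff by auto
  have "bounded_linear (\<lambda>M :: real ^ 'd ^ 'd. M $ i $ j)"
    by (rule bounded_linear_compose[OF bounded_linear_vec_nth bounded_linear_vec_nth])
  from summable_on_bounded_linear[OF this z(2)]
  have "(\<lambda>l. z ^ l * A (int l) $ i $ j) summable_on UNIV" by simp
  then have As: "(\<lambda>l. \<alpha> ^ l * A (int l) $ i $ j) summable_on UNIV"
    by (rule summable_on_comparison_test)
      (use z \<alpha> P0 A[of 1] in \<open>auto intro!: mult_right_mono mult_nonneg_nonneg power_mono\<close>)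
  have pos: "(\<lambda>l. P (k, i) (l, j) * \<alpha> ^ l) summable_on UNIV" if k: "k \<ge> 1" for k
  proof -
    have "summable (\<lambda>l. \<alpha> ^ l * A (int l) $ i $ j)"
      using As by (rule summable_on_imp_summable)
    \<comment> \<open>The factor \<open>\<alpha> ^ k\<close> aligns the exponents with the shifted
      column; the first \<open>k\<close> levels do not affect summability.\<close>
    then have "summable (\<lambda>l. \<alpha> ^ k * (\<alpha> ^ l * A (int l) $ i $ j))"
      by (rule summable_mult)
    then have "summable (\<lambda>l. P (k, i) (l + k, j) * \<alpha> ^ (l + k))"
      by (simp add: A[OF k] power_add mult_ac)
    then have "summable (\<lambda>l. P (k, i) (l, j) * \<alpha> ^ l)"
      by (rule summable_iff_shift[THEN iffD1])
    then show ?thesis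
      using P0 \<alpha> by (subst summable_on_UNIV_nonneg_real_iff) auto
  qed
  show ?thesis
  proof (cases "k = 0")
    case True
    have "(\<lambda>l. P (0, i) (l, j) * \<alpha> ^ l) summable_on UNIV"
    proof -
      have sum: "(\<lambda>l. P x (l, j)) summable_on UNIV" for x
        by (intro summable_on_column prob_vec_summable stochastic_matrixD P)
      show ?thesis
      proof (rule tail_dominated_infsum_le(1)[where q = "\<lambda>l. P (1, i) (l, j)"])
        show "infsum (\<lambda>l. P (0, i) (l, j)) {l..} \<le> infsum (\<lambda>l. P (1, i) (l, j)) {l..}" for l
          using block_monotone_block_le[OF P(3), of 0 1 i] by (simp add: block_le_def)
        show "mono (\<lambda>l. \<alpha> ^ l)" using \<alpha> by (auto simp: mono_def intro: power_increasing)
      qed (use pos[of 1] \<alpha> P0 sum in auto)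
    qed
    then show ?thesis using True by simp
  next
    case False
    then show ?thesis by (intro pos) simp
  qed
qed

section \<open>The lifted drift function\<close>

lemma expect_positive_level:
  fixes p :: "nat \<times> 'd::finite \<Rightarrow> real"
  assumes "prob_vec p"
  shows "expect p (\<lambda>y. of_bool (1 \<le> fst y)) = 1 - (\<Sum>j\<in>UNIV. p (0, j))"
proof -
  have m: "has_mean p (\<lambda>y. of_bool (fst y = 0))" and m1: "has_mean p (\<lambda>_. 1)"
    by (rule has_mean_bounded[OF assms, of _ 1], simp)+
  have "(\<Sum>\<^sub>\<infinity>l. p (l, j) * of_bool (fst (l, j) = 0)) = p (0, j)" for j
  proof -
    have "(\<Sum>\<^sub>\<infinity>l. p (l, j) * of_bool (fst (l, j) = 0)) = (\<Sum>\<^sub>\<infinity>l\<in>{0}. p (l, j))"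
      by (rule infsum_cong_neutral) auto
    then show ?thesis by simp
  qed
  then have "expect p (\<lambda>y. of_bool (fst y = 0)) = (\<Sum>j\<in>UNIV. p (0, j))"
    unfolding expect_def infsum_columns[OF m] by simp
  moreover have "(\<lambda>y :: nat \<times> 'd. of_bool (1 \<le> fst y) :: real) = (\<lambda>y. 1 - of_bool (fst y = 0))"
    by (auto simp: fun_eq_iff)
  ultimately show ?thesis using expect_diff[OF m1 m] expect_const[OF assms, of 1] by simp
qed

text \<open>After multiplication by 1 + \<beta> the sides differ by \<beta> (1 - \<gamma>') (x - 1),
  so the coefficient is exact at x = 1, the smallest value allowed.\<close>

lemma lifted_drift_coefficient:
  fixes \<beta> \<gamma>' x :: real
  assumes "0 < \<beta>" "\<gamma>' < 1" "1 \<le> x"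
  shows "\<gamma>' * x + \<beta> \<le> (\<gamma>' + \<beta>) / (1 + \<beta>) * (x + \<beta>)"
proof -
  have "0 \<le> \<beta> * (1 - \<gamma>') * (x - 1)" using assms by simp
  then have "(\<gamma>' * x + \<beta>) * (1 + \<beta>) \<le> (\<gamma>' + \<beta>) * (x + \<beta>)" by (simp add: algebra_simps)
  then show ?thesis using assms by (simp add: pos_le_divide_eq)
qed

text \<open>What remains is the drift hypothesis of \<open>truncation_error_bound\<close>. On levels
  1 to \<open>K\<close> the lift pays for the excess \<open>b'\<close> of \<open>v'\<close>: a jump
  to level 0 saves \<beta>, and \<beta> is large enough for the expected saving to cover
  \<open>b'\<close>.\<close>

theorem theorem5p1:
  fixes P :: "nat \<times> 'd::finite \<Rightarrow> nat \<times> 'd \<Rightarrow> real"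
    and A B :: "int \<Rightarrow> real ^ 'd ^ 'd"
    and \<pi> \<pi>\<^sub>n :: "nat \<times> 'd \<Rightarrow> real"
    and \<alpha> \<gamma>' b' \<beta> \<gamma> b :: real
    and v\<^sub>A :: "real ^ 'd"
    and v' v :: "nat \<times> 'd \<Rightarrow> real"
    and kstar K n m :: nat
  assumes "stochastic_matrix P"
    and "GI_G_1_form P A B"
    and "block_monotone P"
    and "irreducible_matrix P" and "positive_recurrent P" and "stationary_prob P \<pi>"
    and "irreducible_matrix (\<lambda>i j. (\<Sum>\<^sub>\<infinity>k. A k) $ i $ j)"
    and "stochastic_matrix (\<lambda>i j. (\<Sum>\<^sub>\<infinity>k. A k) $ i $ j)"
    and "r_plus A > 1"
    and "1 < \<alpha>" and "ereal \<alpha> < r_plus A" and "delta_A A \<alpha> < 1"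
    and "A_hat A \<alpha> *v v\<^sub>A = delta_A A \<alpha> *\<^sub>R v\<^sub>A" and "\<forall>i. v\<^sub>A $ i \<ge> 1"
    and "\<forall>k i. v' (k, i) = \<alpha> ^ k * v\<^sub>A $ i"
    and "0 < \<gamma>'" and "\<gamma>' < 1" and "kstar \<ge> 1"
    and "\<forall>k\<ge>kstar. \<forall>i. w_vec P \<alpha> v\<^sub>A k $ i \<le> \<gamma>' * \<alpha> ^ k * v\<^sub>A $ i"
    and "K \<ge> kstar - 1" and "\<forall>i. (B (- int K) *v vec 1) $ i > 0"
    and "b' = Inf {x. x > 0 \<and> (\<forall>k\<le>K. \<forall>i. x \<ge> w_vec P \<alpha> v\<^sub>A k $ i - \<gamma>' * \<alpha> ^ k * v\<^sub>A $ i)}"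
    and "\<beta> > 0" and "\<forall>i. \<beta> * (B (- int K) *v vec 1) $ i \<ge> b'"
    and "\<gamma> = (\<gamma>' + \<beta>) / (1 + \<beta>)"
    and "b = b' + \<beta>"
    and "\<forall>k i. v (k, i) = (if k = 0 then v' (0, i) else v' (k, i) + \<beta>)"
    and "n \<ge> 1" and "m \<ge> 1"
    and "stationary_prob (last_column_truncation n P) \<pi>\<^sub>n"
  shows "l1_norm (\<lambda>x. \<pi>\<^sub>n x - \<pi> x)
           \<le> b / (1 - \<gamma>) * (4 * \<gamma> ^ m + 2 * real m * (\<Sum>i\<in>UNIV. 1 / v (n, i)))"
proof -
  note P = assms(1) and form = assms(2) and mon = assms(3) and \<alpha> = \<open>1 < \<alpha>\<close> and vA = \<open>\<forall>i. v\<^sub>A $ i \<ge> 1\<close>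
    and v' = \<open>\<forall>k i. v' (k, i) = \<alpha> ^ k * v\<^sub>A $ i\<close>
    and v = \<open>\<forall>k i. v (k, i) = (if k = 0 then v' (0, i) else v' (k, i) + \<beta>)\<close>
    and w = \<open>\<forall>k\<ge>kstar. \<forall>i. w_vec P \<alpha> v\<^sub>A k $ i \<le> \<gamma>' * \<alpha> ^ k * v\<^sub>A $ i\<close>
    and \<gamma>' = \<open>0 < \<gamma>'\<close> \<open>\<gamma>' < 1\<close> and \<gamma> = \<open>\<gamma> = (\<gamma>' + \<beta>) / (1 + \<beta>)\<close> and \<beta> = \<open>\<beta> > 0\<close>
  define up :: "nat \<times> 'd \<Rightarrow> real" where "up y = of_bool (1 \<le> fst y)" for y
  have v'_eq: "v' = (\<lambda>x. \<alpha> ^ fst x * v\<^sub>A $ snd x)" using v' by auto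
  have v_eq: "v = (\<lambda>x. v' x + \<beta> * up x)"
    using v by (auto simp: up_def fun_eq_iff)
  have v'1: "1 \<le> v' x" for x
    unfolding v'_eq using mult_mono[of 1 "\<alpha> ^ fst x" 1 "v\<^sub>A $ snd x"] \<alpha> vA by simp
  have "(\<lambda>l. P (k, i) (l, j) * \<alpha> ^ l * v\<^sub>A $ j) summable_on UNIV" for k i j
    by (intro summable_on_cmult_left GI_G_1_column_summable[OF P form mon])
      (use \<alpha> \<open>ereal \<alpha> < r_plus A\<close> in auto)
  then have col: "(\<lambda>l. P (k, i) (l, j) * (\<alpha> ^ l * v\<^sub>A $ j)) summable_on UNIV" for k i j
    by (simp add: mult.assoc)
  have mv': "has_mean (P x) v'" for x
    using w_vec_nth(1)[of P "fst x" \<alpha> v\<^sub>A "snd x", OF col] by (simp add: v'_eq)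
  have wv': "w_vec P \<alpha> v\<^sub>A k $ i = expect (P (k, i)) v'" for k i
    using w_vec_nth(2)[of P k \<alpha> v\<^sub>A i, OF col] by (simp add: v'_eq)
  note px = stochastic_matrixD[OF P]
  have up: "\<bar>up y\<bar> \<le> 1" for y by (simp add: up_def)
  have mup: "has_mean (P x) up" for x by (rule has_mean_bounded[OF px up])
  have mv: "has_mean (P x) v" for x
    unfolding v_eq by (intro has_mean_add has_mean_cmult mv' mup)
  have Pv: "expect (P x) v = expect (P x) v' + \<beta> * expect (P x) up" for x
    unfolding v_eq by (simp add: expect_add[OF mv' has_mean_cmult[OF mup]] expect_cmult)
  have up1: "expect (P x) up \<le> 1" for x using expect_abs_le_const[OF px, of up 1 x] up by auto

  define X where "X = {x. x > 0 \<and> (\<forall>k\<le>K. \<forall>i. x \<ge> w_vec P \<alpha> v\<^sub>A k $ i - \<gamma>' * \<alpha> ^ k * v\<^sub>A $ i)}"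
  have b'X: "b' = Inf X" using assms by (simp add: X_def)
  \<comment> \<open>The infimum behaves as a greatest lower bound only for nonempty
    \<open>X\<close>. There are finitely many constraints; the sum of the absolute values meets them
    all, and adding 1 makes it positive.\<close>
  have "X \<noteq> {}"
  proof -
    define d where "d z = \<bar>w_vec P \<alpha> v\<^sub>A (fst z) $ snd z - \<gamma>' * \<alpha> ^ fst z * v\<^sub>A $ snd z\<bar>" for z
    have d: "d (k, i) \<le> sum d ({..K} \<times> UNIV)" if "k \<le> K" for k i
      using that by (intro member_le_sum) (auto simp: d_def)
    have "w_vec P \<alpha> v\<^sub>A k $ i - \<gamma>' * \<alpha> ^ k * v\<^sub>A $ i \<le> sum d ({..K} \<times> UNIV) + 1"
      if "k \<le> K" for k i
      using d[OF that, of i] abs_ge_self[of "w_vec P \<alpha> v\<^sub>A k $ i - \<gamma>' * \<alpha> ^ k * v\<^sub>A $ i"]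
      unfolding d_def[of "(k, i)"] fst_conv snd_conv by linarith
    moreover have "0 \<le> sum d ({..K} \<times> UNIV)" by (rule sum_nonneg) (simp add: d_def)
    ultimately have "sum d ({..K} \<times> UNIV) + 1 \<in> X" by (simp add: X_def)
    then show ?thesis by blast
  qed
  then have b'0: "0 \<le> b'" unfolding b'X by (rule cInf_greatest) (simp add: X_def)
  \<comment> \<open>Each constrained difference is a lower bound of \<open>X\<close>, hence at most
    its infimum \<open>b'\<close>.\<close>
  have low: "expect (P (k, i)) v' \<le> \<gamma>' * v' (k, i) + b'" if "k \<le> K" for k i
  proof -
    have "w_vec P \<alpha> v\<^sub>A k $ i - \<gamma>' * \<alpha> ^ k * v\<^sub>A $ i \<le> b'"
      unfolding b'X using \<open>X \<noteq> {}\<close> by (rule cInf_greatest) (use that in \<open>auto simp: X_def\<close>)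
    then show ?thesis by (simp add: wv' v'_eq mult.assoc)
  qed
  \<comment> \<open>The bound on \<open>K\<close> puts every level above \<open>K\<close> into the
    range where \<open>w\<close> applies.\<close>
  have high: "expect (P (k, i)) v' \<le> \<gamma>' * v' (k, i)" if "K < k" for k i
    using w \<open>K \<ge> kstar - 1\<close> that by (simp add: wv' v'_eq mult.assoc)
  have return: "b' + \<beta> * expect (P (k, i)) up \<le> \<beta>" if "k \<le> K" for k i
  proof -
    \<comment> \<open>The chance of staying off level 0 grows with the starting level, so
      \<open>K\<close> is the worst case among the levels up to \<open>K\<close>.\<close>
    have "block_incr up" by (rule block_incrI) (simp add: up_def)
    then have "block_incr (\<lambda>x. expect (P x) up)"
      by (rule preserves_block_incrD[OF block_monotone_preserves_block_incr[OF P mon] _ up])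
    from block_incrD[OF this that]
    have "expect (P (k, i)) up \<le> expect (P (K, i)) up" .
    also have "\<dots> = 1 - (\<Sum>j\<in>UNIV. P (K, i) (0, j))"
      unfolding up_def by (rule expect_positive_level[OF px])
    \<comment> \<open>For K = 0 the block comes from the first block row of \<open>P\<close>,
      otherwise from the first block column.\<close>
    also have "(\<Sum>j\<in>UNIV. P (K, i) (0, j)) = (B (- int K) *v vec 1) $ i"
      using GI_G_1_form_nth(1)[OF form, of i 0] GI_G_1_form_nth(2)[OF form, of K i]
      by (cases "K = 0") (simp_all add: matrix_vector_mult_def)
    finally have "\<beta> * expect (P (k, i)) up \<le> \<beta> * (1 - (B (- int K) *v vec 1) $ i)"
      using \<beta> by (intro mult_left_mono) auto
    moreover have "b' \<le> \<beta> * (B (- int K) *v vec 1) $ i"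
      using \<open>\<forall>i. \<beta> * (B (- int K) *v vec 1) $ i \<ge> b'\<close> by blast
    ultimately show ?thesis by (simp add: right_diff_distrib)
  qed
  have lift: "\<gamma>' * v' x + \<beta> \<le> \<gamma> * (v' x + \<beta>)" for x
    unfolding \<gamma> by (rule lifted_drift_coefficient[OF \<beta> \<gamma>'(2) v'1])
  have \<gamma>01: "0 \<le> \<gamma>" "\<gamma> < 1" "\<gamma>' \<le> \<gamma>"
  proof -
    have "0 \<le> \<beta> * (1 - \<gamma>')" using \<beta> \<gamma>' by simp
    then show "0 \<le> \<gamma>" "\<gamma> < 1" "\<gamma>' \<le> \<gamma>"
      unfolding \<gamma> using \<beta> \<gamma>' by (auto simp: pos_le_divide_eq pos_divide_less_eq algebra_simps)
  qed
  have drift: "expect (P (k, i)) v \<le> \<gamma> * v (k, i) + (if k = 0 then b else 0)" for k i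
  proof -
    have \<beta>up: "\<beta> * expect (P (k, i)) up \<le> \<beta>"
      using mult_left_mono[OF up1[of "(k, i)"], of \<beta>] \<beta> by simp
    show ?thesis
    proof (cases "k = 0")
      case True
      \<comment> \<open>At level 0 \<open>v\<close> is not lifted, while a step can gain up to
        \<beta> on top of \<open>b'\<close>; together they make \<open>b\<close>.\<close>
      have "\<gamma>' * v' (k, i) \<le> \<gamma> * v' (k, i)"
        using \<gamma>01(3) v'1[of "(k, i)"] by (intro mult_right_mono) auto
      then show ?thesis
        using True low[of k i] \<beta>up \<open>b = b' + \<beta>\<close> unfolding Pv by (simp add: v_eq up_def)
    next
      case False
      \<comment> \<open>Up to level \<open>K\<close> the possible return to level 0 absorbs
        \<open>b'\<close>; above \<open>K\<close> there is no excess, and the lift adds at most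
        \<beta>.\<close>
      have "expect (P (k, i)) v \<le> \<gamma>' * v' (k, i) + \<beta>"
      proof (cases "k \<le> K")
        case True
        then show ?thesis using low[of k i] return[of k i] unfolding Pv by linarith
      next
        case False
        then show ?thesis using high[of k i] \<beta>up unfolding Pv by linarith
      qed
      then show ?thesis
        using lift[of "(k, i)"] False by (simp add: v_eq up_def)
    qed
  qed
  show ?thesis
  proof (rule truncation_error_bound[OF P mon assms(4,6) \<open>stationary_prob (last_column_truncation n P) \<pi>\<^sub>n\<close>
        _ _ mv drift \<gamma>01(1,2)])
    show "1 \<le> v x" for x using v'1[of x] \<beta> by (simp add: v_eq up_def)
    show "block_incr v"
    proof (rule block_incrI)
      fix k l :: nat and i assume kl: "k \<le> l"
      then have "\<alpha> ^ k * v\<^sub>A $ i \<le> \<alpha> ^ l * v\<^sub>A $ i"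
        using \<alpha> vA[rule_format, of i] by (intro mult_right_mono power_increasing) auto
      then show "v (k, i) \<le> v (l, i)" using kl \<beta> by (simp add: v_eq v'_eq up_def)
    qed
    show "0 \<le> b" using b'0 \<beta> \<open>b = b' + \<beta>\<close> by simp
  qed
qed

end
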